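(* Let $d\geq 1$, let $0<s<d$ be a non-integer real number, and let $\mu$ be a Radon measure on $\mathbb{R}^d$. Then $$\int\int_0^\infty \Delta^s_\mu(x,r)^2\,\frac{dr}{r}\,d\mu(x)\;\approx\;\int \dot W^{\mu}_{\frac23(d-s),\frac32}(x)\,d\mu(x),$$ where the implicit constants depend only on $d$ and $s$ (in particular, one side is finite if and only if the other is).
   Context: For $x\in\mathbb{R}^d$, $r>0$, $s>0$, write $\theta^s_\mu(B(x,r))=\mu(B(x,r))/r^s$ and $$\Delta^s_\mu(x,r)=\frac{\mu(B(x,r))}{r^s}-\frac{\mu(B(x,2r))}{(2r)^s},$$ where $B(x,r)$ is the open ball. The Wolff potential is $\dot W^{\mu}_{\frac23(d-s),\frac32}(x)=\int_0^\infty\left(\frac{\mu(B(x,r))}{r^s}\right)^2\frac{dr}{r}$. The notation $A\approx B$ means $c^{-1}A\le B\le cA$ for a constant $c>0$. *)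

theory Defs
  imports "HOL-Analysis.Analysis"
begin

text \<open>A Radon measure on a Euclidean space: a Borel measure which is locally finite
  (on Euclidean spaces local finiteness already implies regularity).\<close>
definition radon_measure :: "'a::euclidean_space measure \<Rightarrow> bool" where
  "radon_measure M \<longleftrightarrow> sets M = sets borel \<and>
     (\<forall>x r. emeasure M (cball x r) < \<infinity>)"

definition theta :: "real \<Rightarrow> 'a::euclidean_space measure \<Rightarrow> 'a \<Rightarrow> real \<Rightarrow> real" where
  "theta s M x r = measure M (ball x r) / r powr s"

definition Delta :: "real \<Rightarrow> 'a::euclidean_space measure \<Rightarrow> 'a \<Rightarrow> real \<Rightarrow> real" where
  "Delta s M x r = theta s M x r - theta s M x (2 * r)"

definition wolff :: "real \<Rightarrow> real \<Rightarrow> 'a::euclidean_space measure \<Rightarrow> 'a \<Rightarrow> ennreal" where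
  "wolff \<alpha> p M x = (\<integral>\<^sup>+ r \<in> {0<..}.
      ennreal ((measure M (ball x r) / r powr (real DIM('a) - \<alpha> * p)) powr (1 / (p - 1)) / r) \<partial>lborel)"

end

theory Submission
  imports Defs
begin

text \<open>
  If the differences of the density above scale \<open>R\<close> are small compared with the density at scale \<open>R\<close>,
  then the density grows at most like \<open>2 ^ j\<close> on larger scales; otherwise the density at scale \<open>R\<close> is
  controlled pointwise by a geometric sum of differences. In the first case, compactness shows that the
  density is controlled by the energy of the differences in a fixed multiple of the ball: a sequence of
  counterexamples would, after rescaling, have a weak limit whose density differences vanish identically on
  its support. Letting the scale tend to infinity, such a limit gives balls centred on the support a mass
  that depends on the radius only. Among the blow-ups of this limit choose one whose support spans a subspace
  \<open>V\<close> of minimal dimension. If the support is not all of \<open>V\<close>, a blow-up at the support point nearest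
  to a point of \<open>V\<close> outside the support lies in a half space, and comparing the masses around two support points to second order shows
  that a further blow-up lies in a hyperplane (Marstrand's argument), contradicting minimality. If the support
  is \<open>V\<close>, counting balls gives \<open>s = dim V\<close>, which is impossible for non-integer \<open>s\<close>. Finally
  Tonelli and a covering argument sum up the local estimates.
\<close>

subsection \<open>Functions of compact support and a radial kernel\<close>

text \<open>The energy \<open>Delta\<close> uses sharp balls, whose masses need not converge under
  weak limits. Averaging over radii with the weight 4 u (1 - u^2) turns them into integrals of the
  kernel (1 - |y|^2/t^2)^2, which is continuous and smooth enough for a second-order expansion in
  its centre. Vanishing differences compare only the scales t and 2t, so the limit has a mass
  function h with h(2t) = 2^s h(t), not necessarily a power of t; blow-ups are therefore taken along
  powers of 2, which keep the same h. The growth rate 2^j has two jobs: it bounds the mass of every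
  ball for compactness, and its failure produces differences with weights 4^-i, whose sum converges.
  The contradiction sequence ranges over all measures, points and scales, so the constant does not
  depend on the measure. In the final summation the local estimate is multiplied by 1/(R^2
  \<mu>(B(x,R))): the reciprocal mass cancels after integration in x, for every measure, and
  integrating 1/R^2 over R > r/A restores the weight 1/r.\<close>

definition Cc :: "('a::euclidean_space \<Rightarrow> real) set" where
  "Cc = {f. continuous_on UNIV f \<and> (\<exists>R. \<forall>x. R < norm x \<longrightarrow> f x = 0)}"

lemma CcI: "continuous_on UNIV f \<Longrightarrow> (\<And>x. R < norm x \<Longrightarrow> f x = 0) \<Longrightarrow> f \<in> Cc"
  unfolding Cc_def by blast

lemma Cc_continuous: "f \<in> Cc \<Longrightarrow> continuous_on A f"
  unfolding Cc_def using continuous_on_subset by blast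

lemma Cc_bounded_support:
  assumes "f \<in> Cc"
  obtains R where "R > 0" "\<And>x. R < norm x \<Longrightarrow> f x = 0"
proof -
  from assms obtain R where "\<And>x. R < norm x \<Longrightarrow> f x = 0" unfolding Cc_def by blast
  then show thesis using that[of "max R 1"] by auto
qed

lemma Cc_mult_continuous:
  assumes "f \<in> Cc" "continuous_on UNIV g"
  shows "(\<lambda>x. g x * f x) \<in> Cc"
proof -
  obtain R where "\<And>x. R < norm x \<Longrightarrow> f x = 0" using Cc_bounded_support[OF assms(1)] by blast
  then show ?thesis using assms Cc_continuous[OF assms(1)]
    by (intro CcI[of _ R]) (auto intro!: continuous_intros)
qed

lemma Cc_scale: "f \<in> Cc \<Longrightarrow> (\<lambda>x. c * f x) \<in> Cc"
  by (rule Cc_mult_continuous) auto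

lemma Cc_compose2:
  assumes "f \<in> Cc" "g \<in> Cc" "continuous_on UNIV (\<lambda>x. F (f x) (g x))" "F 0 0 = 0"
  shows "(\<lambda>x. F (f x) (g x)) \<in> Cc"
proof -
  obtain R where "\<And>x. R < norm x \<Longrightarrow> f x = 0" using Cc_bounded_support[OF assms(1)] by blast
  moreover obtain R' where "\<And>x. R' < norm x \<Longrightarrow> g x = 0"
    using Cc_bounded_support[OF assms(2)] by blast
  ultimately show ?thesis using assms(3,4)
    by (intro CcI[of _ "max R R'"]) auto
qed

lemma Cc_add: "f \<in> Cc \<Longrightarrow> g \<in> Cc \<Longrightarrow> (\<lambda>x. f x + g x) \<in> Cc"
  using Cc_continuous[of f UNIV] Cc_continuous[of g UNIV]
  by (intro Cc_compose2[of f g "(+)"]) (auto intro: continuous_intros)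

lemma Cc_diff: "f \<in> Cc \<Longrightarrow> g \<in> Cc \<Longrightarrow> (\<lambda>x. f x - g x) \<in> Cc"
  using Cc_continuous[of f UNIV] Cc_continuous[of g UNIV]
  by (intro Cc_compose2[of f g "(-)"]) (auto intro: continuous_intros)

lemma Cc_max: "f \<in> Cc \<Longrightarrow> g \<in> Cc \<Longrightarrow> (\<lambda>x. max (f x) (g x)) \<in> Cc"
  using Cc_continuous[of f UNIV] Cc_continuous[of g UNIV]
  by (intro Cc_compose2[of f g max]) (auto intro: continuous_intros)

lemma Cc_abs: "f \<in> Cc \<Longrightarrow> (\<lambda>x. \<bar>f x\<bar>) \<in> Cc"
  using Cc_continuous[of f UNIV]
  by (intro Cc_compose2[of f f "\<lambda>a b. \<bar>a\<bar>"]) (auto intro: continuous_intros)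

lemma Cc_zero [simp]: "(\<lambda>x. 0) \<in> Cc"
  by (rule CcI[of _ 0]) auto

lemma Cc_sum: "finite I \<Longrightarrow> (\<And>i. i \<in> I \<Longrightarrow> f i \<in> Cc) \<Longrightarrow> (\<lambda>x. \<Sum>i\<in>I. f i x) \<in> Cc"
  by (induction I rule: finite_induct) (auto intro!: Cc_add)

lemma Cc_affine:
  fixes f :: "'a::euclidean_space \<Rightarrow> real"
  assumes "f \<in> Cc" "c > 0"
  shows "(\<lambda>x. f (c *\<^sub>R (x - a))) \<in> Cc"
proof -
  obtain R where R: "R > 0" "\<And>x. R < norm x \<Longrightarrow> f x = 0" using Cc_bounded_support[OF assms(1)] by blast
  show ?thesis
  proof (rule CcI[of _ "R / c + norm a"])
    show "continuous_on UNIV (\<lambda>x. f (c *\<^sub>R (x - a)))"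
      by (rule continuous_on_compose2[OF Cc_continuous[OF assms(1), of UNIV]])
        (auto intro!: continuous_intros)
    fix x :: 'a assume "R / c + norm a < norm x"
    then have "R / c < norm (x - a)" using norm_triangle_sub[of x a] by linarith
    then have "R < c * norm (x - a)" using assms(2) by (simp add: field_simps)
    then show "f (c *\<^sub>R (x - a)) = 0" using assms(2) by (intro R) auto
  qed
qed

lemma Cc_bounded:
  assumes "f \<in> Cc"
  obtains B where "B > 0" "\<And>x. \<bar>f x\<bar> \<le> B"
proof -
  obtain R where R: "R > 0" "\<And>x. R < norm x \<Longrightarrow> f x = 0" using Cc_bounded_support[OF assms] by blast
  have "compact (f ` cball 0 R)"
    by (intro compact_continuous_image Cc_continuous assms) auto
  then obtain B where B: "B > 0" "\<And>y. y \<in> f ` cball 0 R \<Longrightarrow> norm y \<le> B"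
    using bounded_pos compact_imp_bounded by metis
  have "\<bar>f x\<bar> \<le> B" for x
    using B(2)[of "f x"] R(2)[of x] B(1) by (cases "norm x \<le> R") auto
  with B(1) that show thesis by blast
qed

section \<open>The radial kernel and its Lipschitz bounds\<close>

definition bump1 :: "real \<Rightarrow> 'a::euclidean_space \<Rightarrow> real" where
  "bump1 t y = max 0 (1 - (norm y / t)\<^sup>2)"

text \<open>As a function of the squared distance this is the square of the positive part of an
  affine function. The square makes it differentiable across the boundary sphere, with gradient a
  multiple of \<open>bump1\<close> times the displacement, and it is positive exactly on the open
  ball.\<close>

definition bump :: "'a::euclidean_space \<Rightarrow> real \<Rightarrow> 'a \<Rightarrow> real" where
  "bump x t y = (bump1 t (y - x))\<^sup>2"

lemma bump1_nonneg [simp]: "0 \<le> bump1 t y" by (simp add: bump1_def)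
lemma bump1_le_one: "bump1 t y \<le> 1" by (simp add: bump1_def)

lemma bump1_eq_0: "t > 0 \<Longrightarrow> bump1 t y = 0 \<longleftrightarrow> t \<le> norm y"
  using abs_square_less_1[of "norm y / t"] by (auto simp: bump1_def max_def not_less not_le field_simps)

lemma bump1_continuous: "t > 0 \<Longrightarrow> continuous_on UNIV (bump1 t)"
  unfolding bump1_def by (intro continuous_intros) auto

lemma bump1_Cc: "t > 0 \<Longrightarrow> bump1 t \<in> Cc"
  by (rule CcI[of _ t]) (auto simp: bump1_continuous bump1_eq_0)

lemma bump_nonneg [simp]: "0 \<le> bump x t y" by (simp add: bump_def)
lemma bump_le_one: "bump x t y \<le> 1"
  by (simp add: bump_def power_le_one bump1_le_one)

lemma bump_eq_0: "t > 0 \<Longrightarrow> bump x t y = 0 \<longleftrightarrow> t \<le> dist x y"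
  by (auto simp: bump_def bump1_eq_0 dist_norm norm_minus_commute)

lemma bump_pos: "t > 0 \<Longrightarrow> 0 < bump x t y \<longleftrightarrow> dist x y < t"
  using bump_eq_0[of t x y] bump_nonneg[of x t y] by linarith

lemma bump_Cc: "t > 0 \<Longrightarrow> bump x t \<in> Cc"
proof (rule CcI[of _ "norm x + t"])
  assume t: "t > 0"
  show "continuous_on UNIV (bump x t)"
    unfolding bump_def bump1_def using t by (intro continuous_intros) auto
  fix y :: 'a assume "norm x + t < norm y"
  then have "t \<le> dist x y" unfolding dist_norm by norm
  then show "bump x t y = 0" using t by (simp add: bump_eq_0)
qed

lemma bump_affine: "c > 0 \<Longrightarrow> bump z t (c *\<^sub>R (y - a)) = bump (a + z /\<^sub>R c) (t / c) y"
proof -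
  assume c: "c > 0"
  have "c *\<^sub>R (y - a) - z = c *\<^sub>R (y - (a + z /\<^sub>R c))" using c by (simp add: algebra_simps)
  then have "norm (c *\<^sub>R (y - a) - z) = c * norm (y - (a + z /\<^sub>R c))" using c by simp
  then show ?thesis by (simp add: bump_def bump1_def mult.commute)
qed

lemma bump_ge_half: "t > 0 \<Longrightarrow> dist x y \<le> t / 2 \<Longrightarrow> 1/2 \<le> bump x t y"
proof -
  assume t: "t > 0" and d: "dist x y \<le> t / 2"
  have "(norm (y - x) / t)\<^sup>2 \<le> (1/2)\<^sup>2"
    using t d by (intro power_mono) (auto simp: dist_norm norm_minus_commute field_simps)
  then have "3/4 \<le> bump1 t (y - x)" by (simp add: bump1_def le_max_iff_disj power_divide)
  then have "(3/4)\<^sup>2 \<le> bump x t y" unfolding bump_def by (intro power_mono) auto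
  then show ?thesis by (simp add: power2_eq_square)
qed

lemma bump_lipschitz0:
  assumes t: "t > 0"
  shows "\<bar>bump x t y - bump x' t y\<bar> \<le> 4 * dist x x' / t"
proof -
  \<comment> \<open>Truncating at 1 leaves the kernel unchanged and puts all quantities in [0,1],
    where squaring is 2-Lipschitz; the kernel squares twice, hence the factor 4.\<close>
  let ?u = "min 1 (norm (y - x) / t)" and ?v = "min 1 (norm (y - x') / t)"
  have k: "bump1 t z = 1 - (min 1 (norm z / t))\<^sup>2" for z :: 'a
    using t abs_square_le_1[of "norm z / t"] by (auto simp: bump1_def min_def max_def)
  have uv: "\<bar>?u - ?v\<bar> \<le> dist x x' / t"
  proof -
    have "\<bar>?u - ?v\<bar> \<le> \<bar>norm (y - x) / t - norm (y - x') / t\<bar>" by linarith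
    also have "\<dots> = \<bar>norm (y - x) - norm (y - x')\<bar> / t" using t by (simp add: diff_divide_distrib[symmetric])
    also have "\<dots> \<le> dist x x' / t"
      using t norm_triangle_ineq3[of "y - x" "y - x'"]
      by (intro divide_right_mono) (auto simp: dist_norm norm_minus_commute)
    finally show ?thesis .
  qed
  have b: "\<bar>a\<^sup>2 - b\<^sup>2\<bar> \<le> 2 * \<bar>a - b\<bar>" if "0 \<le> a" "a \<le> 1" "0 \<le> b" "b \<le> 1" for a b :: real
  proof -
    have "\<bar>a\<^sup>2 - b\<^sup>2\<bar> = (a + b) * \<bar>a - b\<bar>" using that
      by (simp add: power2_eq_square square_diff_square_factored abs_mult)
    also have "\<dots> \<le> 2 * \<bar>a - b\<bar>" using that by (intro mult_right_mono) auto
    finally show ?thesis .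
  qed
  have uv0: "0 \<le> ?u" "?u \<le> 1" "0 \<le> ?v" "?v \<le> 1" using t by auto
  have "\<bar>bump x t y - bump x' t y\<bar> \<le> 2 * \<bar>bump1 t (y - x) - bump1 t (y - x')\<bar>"
    unfolding bump_def by (intro b) (auto simp: bump1_le_one)
  also have "\<dots> = 2 * \<bar>?u\<^sup>2 - ?v\<^sup>2\<bar>" by (simp add: k abs_minus_commute)
  also have "\<dots> \<le> 2 * (2 * \<bar>?u - ?v\<bar>)" using b[OF uv0] by simp
  also have "\<dots> \<le> 4 * dist x x' / t" using uv by simp
  finally show ?thesis .
qed

text \<open>The bound is again a multiple of a bump, so a positive functional can be applied to it.
  Both supports lie within 2t of \<open>x\<close>, where \<open>bump x (4 * t)\<close> is at least
  1/2; this turns the factor 4 into 8.\<close>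

lemma bump_lipschitz:
  assumes t: "t > 0" and d: "dist x x' \<le> t"
  shows "\<bar>bump x t y - bump x' t y\<bar> \<le> 8 * dist x x' / t * bump x (4 * t) y"
proof (cases "dist x y \<le> 2 * t")
  case True
  then have "1/2 \<le> bump x (4 * t) y" using t by (intro bump_ge_half) auto
  then have "4 * dist x x' / t * 1 \<le> 4 * dist x x' / t * (2 * bump x (4 * t) y)"
    using t by (intro mult_left_mono) auto
  then show ?thesis using bump_lipschitz0[OF t, of x y x'] by simp
next
  case False
  then have "t \<le> dist x' y" using d dist_triangle[of x y x'] by simp
  then have "bump x t y = 0" "bump x' t y = 0" using False t bump_eq_0 by (auto simp: bump_eq_0)
  then show ?thesis using t by simp
qed

subsection \<open>Positive functionals\<close>

text \<open>Weak limits of measures are used only through their values on \<open>Cc\<close>, so no representation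
  theorem is needed.\<close>

locale pos_functional =
  fixes \<Lambda> :: "('a::euclidean_space \<Rightarrow> real) \<Rightarrow> real"
  assumes add: "f \<in> Cc \<Longrightarrow> g \<in> Cc \<Longrightarrow> \<Lambda> (\<lambda>x. f x + g x) = \<Lambda> f + \<Lambda> g"
    and scale: "f \<in> Cc \<Longrightarrow> \<Lambda> (\<lambda>x. c * f x) = c * \<Lambda> f"
    and nonneg: "f \<in> Cc \<Longrightarrow> (\<And>x. 0 \<le> f x) \<Longrightarrow> 0 \<le> \<Lambda> f"
begin

lemma diff: "f \<in> Cc \<Longrightarrow> g \<in> Cc \<Longrightarrow> \<Lambda> (\<lambda>x. f x - g x) = \<Lambda> f - \<Lambda> g"
  using add[of f "\<lambda>x. -1 * g x"] scale[of g "-1"] Cc_scale[of g "-1"] by simp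

lemma zero: "\<Lambda> (\<lambda>x. 0) = 0"
  using scale[of "\<lambda>x. 0" 0] by simp

lemma sum: "finite I \<Longrightarrow> (\<And>i. i \<in> I \<Longrightarrow> f i \<in> Cc) \<Longrightarrow> \<Lambda> (\<lambda>x. \<Sum>i\<in>I. f i x) = (\<Sum>i\<in>I. \<Lambda> (f i))"
  by (induction I rule: finite_induct) (auto simp: zero add Cc_sum)

lemma mono: "f \<in> Cc \<Longrightarrow> g \<in> Cc \<Longrightarrow> (\<And>x. f x \<le> g x) \<Longrightarrow> \<Lambda> f \<le> \<Lambda> g"
  using nonneg[of "\<lambda>x. g x - f x"] diff[of g f] Cc_diff[of g f] by simp

lemma abs_le: "f \<in> Cc \<Longrightarrow> g \<in> Cc \<Longrightarrow> (\<And>x. \<bar>f x\<bar> \<le> g x) \<Longrightarrow> \<bar>\<Lambda> f\<bar> \<le> \<Lambda> g"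
  using mono[of f g] mono[of "\<lambda>x. -1 * f x" g] scale[of f "-1"] Cc_scale[of f "-1"]
  by (simp add: abs_le_iff)

lemma bump_nonneg: "t > 0 \<Longrightarrow> 0 \<le> \<Lambda> (bump x t)"
  by (rule nonneg) (auto simp: bump_Cc)

lemma bump_lipschitz:
  assumes t: "t > 0" and d: "dist x x' \<le> t"
  shows "\<bar>\<Lambda> (bump x t) - \<Lambda> (bump x' t)\<bar> \<le> 8 * dist x x' / t * \<Lambda> (bump x (4 * t))"
proof -
  have "\<bar>\<Lambda> (\<lambda>y. bump x t y - bump x' t y)\<bar> \<le> \<Lambda> (\<lambda>y. 8 * dist x x' / t * bump x (4 * t) y)"
    using t d by (intro abs_le Cc_diff Cc_scale bump_Cc bump_lipschitz) auto
  moreover have "\<Lambda> (\<lambda>y. 8 * dist x x' / t * bump x (4 * t) y) = 8 * dist x x' / t * \<Lambda> (bump x (4 * t))"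
    using t by (intro scale bump_Cc) auto
  ultimately show ?thesis using t by (simp only: diff bump_Cc)
qed

text \<open>Since a bump is positive exactly on an open ball, this is the topological support of the
  measure behind \<Lambda>, expressed through test functions only.\<close>

definition supp :: "'a set" where
  "supp = {x. \<forall>t>0. 0 < \<Lambda> (bump x t)}"

lemma not_supp: 
  assumes "x \<notin> supp"
  obtains t where "t > 0" "\<Lambda> (bump x t) = 0"
proof -
  from assms obtain t where "t > 0" "\<not> 0 < \<Lambda> (bump x t)" unfolding supp_def by blast
  with bump_nonneg[of t x] that show thesis by force
qed

lemma closed_supp: "closed supp"
  unfolding closed_def open_dist
proof (intro ballI)
  fix x assume "x \<in> - supp"
  then obtain t where t: "t > 0" "\<Lambda> (bump x t) = 0" using not_supp by auto
  have "x' \<notin> supp" if x': "dist x' x < t / 4" for x'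
  proof -
    \<comment> \<open>The small ball lies inside the half-size ball around \<open>x\<close>, where
      \<open>bump x t\<close> is at least 1/2.\<close>
    have le: "bump x' (t / 4) y \<le> 2 * bump x t y" for y
    proof (cases "dist x' y < t / 4")
      case True
      then have "dist x y \<le> t / 2" using x' dist_triangle[of x y x'] by (simp add: dist_commute)
      then have "1/2 \<le> bump x t y" using t bump_ge_half by blast
      then show ?thesis using bump_le_one[of x' "t/4" y] by simp
    next
      case False
      then have "bump x' (t / 4) y = 0" using t by (simp add: bump_eq_0)
      then show ?thesis by simp
    qed
    have "\<Lambda> (bump x' (t / 4)) \<le> \<Lambda> (\<lambda>y. 2 * bump x t y)"
      using t le by (intro mono Cc_scale bump_Cc) auto
    then have "\<not> 0 < \<Lambda> (bump x' (t / 4))" using t by (simp add: scale bump_Cc)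
    then show ?thesis unfolding supp_def using t by force
  qed
  then show "\<exists>e>0. \<forall>y. dist y x < e \<longrightarrow> y \<in> - supp" using t by (intro exI[of _ "t/4"]) auto
qed

text \<open>Compactness gives finitely many null bumps whose sum \<open>g\<close> is bounded below
  on \<open>C\<close>; a multiple of \<open>g\<close> dominates |f| and has value zero.\<close>

lemma null_compact:
  assumes f: "f \<in> Cc" and C: "compact C" "C \<inter> supp = {}" and out: "\<And>x. x \<notin> C \<Longrightarrow> f x = 0"
  shows "\<Lambda> f = 0"
proof -
  have "\<exists>t. t > 0 \<and> \<Lambda> (bump x t) = 0" if "x \<in> C" for x using not_supp[of x] C(2) that by auto
  then obtain t where t: "\<And>x. x \<in> C \<Longrightarrow> t x > 0 \<and> \<Lambda> (bump x (t x)) = 0" by metis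
  have "C \<subseteq> (\<Union>x\<in>C. ball x (t x))" using t by force
  then obtain D where D: "D \<subseteq> C" "finite D" "C \<subseteq> (\<Union>x\<in>D. ball x (t x))"
    using compactE_image[OF C(1), of C "\<lambda>x. ball x (t x)"] by auto
  define g where "g = (\<lambda>y. \<Sum>x\<in>D. bump x (t x) y)"
  have tD: "\<And>x. x \<in> D \<Longrightarrow> t x > 0" using D t by auto
  have g: "g \<in> Cc" unfolding g_def using D t by (intro Cc_sum bump_Cc) auto
  have g0: "g y \<ge> 0" for y unfolding g_def by (intro sum_nonneg) auto
  have Lg: "\<Lambda> g = 0" unfolding g_def using D t tD by (subst sum) (auto intro!: bump_Cc sum.neutral)
  have gpos: "g y > 0" if y: "y \<in> C" for y
  proof -
    obtain x where x: "x \<in> D" "dist x y < t x" using D(3) y by force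
    show ?thesis unfolding g_def
      using x tD D(2) by (intro sum_pos2[of D x]) (auto simp: bump_pos)
  qed
  obtain B where B: "B > 0" "\<And>x. \<bar>f x\<bar> \<le> B" using Cc_bounded[OF f] by blast
  obtain m where m: "m > 0" "\<And>y. y \<in> C \<Longrightarrow> m \<le> g y"
  proof (cases "C = {}")
    case True then show ?thesis using that[of 1] by auto
  next
    case False
    then obtain y0 where "y0 \<in> C" "\<And>y. y \<in> C \<Longrightarrow> g y0 \<le> g y"
      using continuous_attains_inf[OF C(1) False Cc_continuous[OF g]] by auto
    then show ?thesis using that[of "g y0"] gpos by auto
  qed
  have "\<bar>f x\<bar> \<le> B / m * g x" for x
  proof (cases "x \<in> C")
    case True
    have "B = B / m * m" using m by simp
    also have "\<dots> \<le> B / m * g x" using m(2)[OF True] m(1) B(1) by (intro mult_left_mono) auto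
    finally show ?thesis using B(2)[of x] by simp
  next
    case False
    then show ?thesis using out g0 m B by simp
  qed
  then have "\<bar>\<Lambda> f\<bar> \<le> \<Lambda> (\<lambda>x. B / m * g x)" using f g by (intro abs_le Cc_scale) auto
  then show ?thesis by (subst (asm) scale) (simp_all add: g Lg)
qed

text \<open>The set where \<open>f\<close> is nonzero may come arbitrarily close to the support, so
  the compact case does not apply directly. Cutting off at height \<epsilon> leaves a function
  living on a compact set away from the support, and the part cut off costs at most \<epsilon> times
  a fixed value.\<close>

lemma null_supp:
  assumes f: "f \<in> Cc" and z: "\<And>x. x \<in> supp \<Longrightarrow> f x = 0"
  shows "\<Lambda> f = 0"
proof -
  obtain R where R: "R > 0" "\<And>x. R < norm x \<Longrightarrow> f x = 0" using Cc_bounded_support[OF f] by blast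
  define \<eta> :: "'a \<Rightarrow> real" where "\<eta> = (\<lambda>y. 2 * bump 0 (2 * R) y)"
  have \<eta>: "\<eta> \<in> Cc" unfolding \<eta>_def using R by (intro Cc_scale bump_Cc) auto
  have \<eta>1: "norm x \<le> R \<Longrightarrow> 1 \<le> \<eta> x" for x
    unfolding \<eta>_def using bump_ge_half[of "2*R" 0 x] R by (simp add: dist_norm)
  have \<eta>0: "0 \<le> \<eta> x" for x by (simp add: \<eta>_def)
  have "\<bar>\<Lambda> f\<bar> \<le> \<epsilon> * \<Lambda> \<eta>" if e: "\<epsilon> > 0" for \<epsilon>
  proof -
    define g where "g = (\<lambda>x. max 0 (\<bar>f x\<bar> - \<epsilon> * \<eta> x))"
    define C where "C = {x\<in>cball 0 R. \<epsilon> \<le> \<bar>f x\<bar>}"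
    have g: "g \<in> Cc" unfolding g_def using f \<eta> by (intro Cc_max Cc_diff Cc_abs Cc_scale Cc_zero)
    have "closed {x\<in>cball 0 R. \<bar>f x\<bar> \<in> {\<epsilon>..}}"
      by (intro continuous_closed_preimage[unfolded vimage_def Int_def mem_Collect_eq, simplified])
        (auto intro!: continuous_intros Cc_continuous[OF f])
    then have "compact C" unfolding C_def compact_eq_bounded_closed
      by (auto intro: bounded_subset[OF bounded_cball, of _ 0 R])
    moreover have "C \<inter> supp = {}" using z e by (auto simp: C_def)
    moreover have "g x = 0" if "x \<notin> C" for x
    proof (cases "norm x \<le> R")
      case True
      then have "\<bar>f x\<bar> < \<epsilon>" using that by (auto simp: C_def)
      also have "\<epsilon> \<le> \<epsilon> * \<eta> x" using \<eta>1[OF True] e by simp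
      finally show ?thesis by (simp add: g_def)
    next
      case False
      then show ?thesis using R(2)[of x] \<eta>0[of x] e by (simp add: g_def)
    qed
    ultimately have "\<Lambda> g = 0" using null_compact[OF g] by blast
    moreover have "\<bar>\<Lambda> f\<bar> \<le> \<Lambda> (\<lambda>x. g x + \<epsilon> * \<eta> x)"
      using f g \<eta> by (intro abs_le Cc_add Cc_scale) (auto simp: g_def)
    ultimately show ?thesis using g \<eta> by (simp add: add scale Cc_scale)
  qed
  then have "\<bar>\<Lambda> f\<bar> \<le> e" if "e > 0" for e
  proof -
    have L: "0 \<le> \<Lambda> \<eta>" using nonneg[OF \<eta> \<eta>0] .
    have "\<bar>\<Lambda> f\<bar> \<le> e / (1 + \<Lambda> \<eta>) * \<Lambda> \<eta>" using that L \<open>\<And>\<epsilon>. \<epsilon> > 0 \<Longrightarrow> _\<close>[of "e / (1 + \<Lambda> \<eta>)"] by simp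
    also have "\<dots> \<le> e" using that L by (simp add: field_simps)
    finally show ?thesis .
  qed
  then show ?thesis by (metis abs_le_zero_iff field_le_epsilon add_0)
qed

text \<open>Covering arguments supply inequalities only at support points; the excess
  \<open>?d\<close> vanishes there and contributes nothing.\<close>

lemma mono_supp:
  assumes "f \<in> Cc" "g \<in> Cc" "\<And>x. x \<in> supp \<Longrightarrow> f x \<le> g x"
  shows "\<Lambda> f \<le> \<Lambda> g"
proof -
  let ?d = "\<lambda>x. max 0 (f x - g x)"
  have d: "?d \<in> Cc" using assms by (intro Cc_max Cc_diff Cc_zero)
  have "\<Lambda> f \<le> \<Lambda> (\<lambda>x. g x + ?d x)" using assms d by (intro mono Cc_add) auto
  also have "\<dots> = \<Lambda> g" using null_supp[OF d] assms d by (simp add: add)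
  finally show ?thesis .
qed

end

section \<open>Weak cluster points of positive functionals\<close>

lemma compact_functions:
  fixes K :: "'b \<Rightarrow> real"
  shows "compact (Pi\<^sub>E UNIV (\<lambda>i. {-K i..K i}))"
proof -
  have "compactin (product_topology (\<lambda>i::'b. euclidean::real topology) UNIV) (Pi\<^sub>E UNIV (\<lambda>i. {-K i..K i}))"
    by (auto simp: compactin_PiE)
  then show ?thesis by (simp add: euclidean_product_topology)
qed

text \<open>The product topology is not metrizable in general, so the limit is taken along a filter instead
  of a subsequence.\<close>

lemma cluster_filter:
  fixes \<Lambda> :: "nat \<Rightarrow> 'b \<Rightarrow> real"
  assumes "\<And>n i. \<bar>\<Lambda> n i\<bar> \<le> K i"
  obtains F L where "F \<noteq> bot" "F \<le> sequentially" "\<And>i. ((\<lambda>n. \<Lambda> n i) \<longlongrightarrow> L i) F"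
proof -
  let ?U = "Pi\<^sub>E UNIV (\<lambda>i. {-K i..K i})"
  have "\<Lambda> n \<in> ?U" for n using assms by (auto simp: abs_le_iff minus_le_iff)
  then have ev: "eventually (\<lambda>x. x \<in> ?U) (filtermap \<Lambda> sequentially)" by (simp add: eventually_filtermap)
  obtain L where L: "inf (nhds L) (filtermap \<Lambda> sequentially) \<noteq> bot"
    using compact_functions[of K, unfolded compact_filter, rule_format, OF _ ev]
    by (auto simp: filtermap_bot_iff)
  \<comment> \<open>Pulling the neighbourhoods of the cluster point back to the indices and
    intersecting with the tail filter gives convergence and arbitrarily large indices at
    once.\<close>
  define F where "F = inf (filtercomap \<Lambda> (nhds L)) sequentially"
  have "F \<noteq> bot"
  proof
    assume "F = bot"
    then have "eventually (\<lambda>_. False) F" by simp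
    then obtain P Q where PQ: "eventually P (filtercomap \<Lambda> (nhds L))" "eventually Q sequentially"
      "\<And>x. P x \<Longrightarrow> Q x \<Longrightarrow> False"
      unfolding F_def eventually_inf by blast
    obtain S where S: "eventually S (nhds L)" "\<And>x. S (\<Lambda> x) \<Longrightarrow> P x"
      using PQ(1) unfolding eventually_filtercomap by blast
    have "eventually (\<lambda>y. \<not> S y) (filtermap \<Lambda> sequentially)"
      unfolding eventually_filtermap using PQ(2) by eventually_elim (use S PQ in blast)
    then have "eventually (\<lambda>_. False) (inf (nhds L) (filtermap \<Lambda> sequentially))"
      unfolding eventually_inf using S(1) by blast
    then show False using L by (simp add: trivial_limit_def)
  qed
  moreover have "F \<le> sequentially" by (simp add: F_def)
  moreover have "((\<lambda>n. \<Lambda> n i) \<longlongrightarrow> L i) F" for i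
  proof -
    have "filterlim \<Lambda> (nhds L) F"
      unfolding F_def filterlim_iff_le_filtercomap by simp
    moreover have "((\<lambda>x. x i) \<longlongrightarrow> L i) (nhds L)"
      using continuous_on_product_coordinates[of i] tendsto_at_iff_tendsto_nhds[of "\<lambda>x. x i" L]
      unfolding continuous_on_def by blast
    ultimately show ?thesis using filterlim_compose by fast
  qed
  ultimately show thesis using that by blast
qed

text \<open>Bounds on bumps at the origin suffice, because every function in \<open>Cc\<close> is
  dominated by a multiple of one such bump.\<close>

lemma pos_functional_cluster:
  fixes \<Lambda> :: "nat \<Rightarrow> ('a::euclidean_space \<Rightarrow> real) \<Rightarrow> real"
  assumes pos: "\<And>n. pos_functional (\<Lambda> n)" and bdd: "\<And>t. t > 0 \<Longrightarrow> \<exists>C. \<forall>n. \<Lambda> n (bump 0 t) \<le> C"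
  obtains F L where "F \<noteq> bot" "F \<le> sequentially" "pos_functional L"
    "\<And>f. f \<in> Cc \<Longrightarrow> ((\<lambda>n. \<Lambda> n f) \<longlongrightarrow> L f) F"
proof -
  have "\<exists>C. \<forall>n. \<bar>\<Lambda> n f\<bar> \<le> C" if f: "f \<in> Cc" for f
  proof -
    obtain R where R: "R > 0" "\<And>x. R < norm x \<Longrightarrow> f x = 0" using Cc_bounded_support[OF f] by blast
    obtain B where B: "B > 0" "\<And>x. \<bar>f x\<bar> \<le> B" using Cc_bounded[OF f] by blast
    obtain C where C: "\<And>n. \<Lambda> n (bump 0 (2 * R)) \<le> C" using bdd[of "2*R"] R by auto
    have fle: "\<bar>f x\<bar> \<le> 2 * B * bump 0 (2 * R) x" for x
    proof (cases "norm x \<le> R")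
      case True
      then have "1/2 \<le> bump 0 (2 * R) x" using R by (intro bump_ge_half) (auto simp: dist_norm)
      then have "2 * B * (1/2) \<le> 2 * B * bump 0 (2 * R) x" using B(1) by (intro mult_left_mono) auto
      then show ?thesis using B(2)[of x] by simp
    next
      case False then show ?thesis using R(2)[of x] B(1) by simp
    qed
    have "\<bar>\<Lambda> n f\<bar> \<le> 2 * B * C" for n
    proof -
      interpret pos_functional "\<Lambda> n" by (rule pos)
      have "\<bar>\<Lambda> n f\<bar> \<le> \<Lambda> n (\<lambda>x. 2 * B * bump 0 (2 * R) x)"
        using f R(1) fle by (intro abs_le Cc_scale bump_Cc) auto
      also have "\<dots> = 2 * B * \<Lambda> n (bump 0 (2 * R))" using R(1) by (intro scale bump_Cc) auto
      also have "\<dots> \<le> 2 * B * C" using B(1) C by (intro mult_left_mono) auto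
      finally show ?thesis .
    qed
    then show ?thesis by blast
  qed
  then obtain K where K: "\<And>f n. f \<in> Cc \<Longrightarrow> \<bar>\<Lambda> n f\<bar> \<le> K f" by metis
  \<comment> \<open>Functions outside \<open>Cc\<close> carry no bound; the value 0 there lets the
    coordinatewise compactness apply to all functions.\<close>
  define \<Lambda>' where "\<Lambda>' = (\<lambda>n f. if f \<in> Cc then \<Lambda> n f else 0)"
  have "\<bar>\<Lambda>' n f\<bar> \<le> (if f \<in> Cc then K f else 0)" for n f using K by (simp add: \<Lambda>'_def)
  from cluster_filter[of \<Lambda>', OF this]
  obtain F L where F: "F \<noteq> bot" "F \<le> sequentially" "\<And>i. ((\<lambda>n. \<Lambda>' n i) \<longlongrightarrow> L i) F"
    by blast
  have lim: "((\<lambda>n. \<Lambda> n f) \<longlongrightarrow> L f) F" if "f \<in> Cc" for f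
    using F(3)[of f] that by (simp add: \<Lambda>'_def)
  have "pos_functional L"
  proof
    fix f g :: "'a \<Rightarrow> real" assume fg: "f \<in> Cc" "g \<in> Cc"
    have "((\<lambda>n. \<Lambda> n f + \<Lambda> n g) \<longlongrightarrow> L f + L g) F" using fg by (intro tendsto_add lim)
    then have "((\<lambda>n. \<Lambda> n (\<lambda>x. f x + g x)) \<longlongrightarrow> L f + L g) F"
      using fg by (simp add: pos_functional.add[OF pos])
    then show "L (\<lambda>x. f x + g x) = L f + L g"
      by (rule tendsto_unique[OF F(1) lim[OF Cc_add[OF fg]]])
  next
    fix f :: "'a \<Rightarrow> real" and c assume f: "f \<in> Cc"
    have "((\<lambda>n. c * \<Lambda> n f) \<longlongrightarrow> c * L f) F" using f by (intro tendsto_mult lim) auto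
    then have "((\<lambda>n. \<Lambda> n (\<lambda>x. c * f x)) \<longlongrightarrow> c * L f) F"
      using f by (simp add: pos_functional.scale[OF pos])
    then show "L (\<lambda>x. c * f x) = c * L f"
      by (rule tendsto_unique[OF F(1) lim[OF Cc_scale[OF f]]])
  next
    fix f :: "'a \<Rightarrow> real" assume f: "f \<in> Cc" "\<And>x. 0 \<le> f x"
    have "0 \<le> \<Lambda> n f" for n using f by (rule pos_functional.nonneg[OF pos])
    then show "0 \<le> L f" by (intro tendsto_lowerbound[OF lim[OF f(1)] _ F(1)] always_eventually allI)
  qed
  with F(1,2) show thesis using lim by (rule that)
qed

context pos_functional begin

text \<open>Compare two points of the support at scale \<open>2 ^ n * t\<close>, where their distance is negligible.\<close>

lemma bump_independent:
  assumes per: "\<And>x t. x \<in> supp \<Longrightarrow> t > 0 \<Longrightarrow> \<Lambda> (bump x (2 * t)) = 2 powr s * \<Lambda> (bump x t)"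
    and x: "x \<in> supp" and y: "y \<in> supp" and t: "t > 0"
  shows "\<Lambda> (bump x t) = \<Lambda> (bump y t)"
proof -
  define q :: real where "q = 2 powr s"
  have q: "q > 0" by (simp add: q_def)
  have it: "\<Lambda> (bump z (2 ^ n * t)) = q ^ n * \<Lambda> (bump z t)" if "z \<in> supp" for z n
  proof (induction n)
    case (Suc n)
    have "\<Lambda> (bump z (2 * (2 ^ n * t))) = q * \<Lambda> (bump z (2 ^ n * t))"
      unfolding q_def using that t by (intro per) auto
    then show ?case using Suc by (simp add: mult.assoc)
  qed simp
  \<comment> \<open>The factor q^2 comes from the radius 4 = 2^2 in the Lipschitz bound.\<close>
  let ?c = "8 * dist x y / t * (q\<^sup>2 * \<Lambda> (bump x t))"
  have "eventually (\<lambda>n. dist x y \<le> 2 ^ n * t) sequentially"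
  proof -
    obtain N where N: "dist x y / t < 2 ^ N" using real_arch_pow[of 2 "dist x y / t"] by auto
    have "dist x y \<le> 2 ^ n * t" if "N \<le> n" for n
    proof -
      have "dist x y \<le> 2 ^ N * t" using N t by (simp add: field_simps)
      also have "\<dots> \<le> 2 ^ n * t" using that t by (intro mult_right_mono power_increasing) auto
      finally show ?thesis .
    qed
    then show ?thesis by (intro eventually_sequentiallyI) 
  qed
  then have ev: "eventually (\<lambda>n. \<bar>\<Lambda> (bump x t) - \<Lambda> (bump y t)\<bar> \<le> ?c * (1/2) ^ n) sequentially"
  proof eventually_elim
    case (elim n)
    have "\<bar>\<Lambda> (bump x (2 ^ n * t)) - \<Lambda> (bump y (2 ^ n * t))\<bar> \<le> 8 * dist x y / (2 ^ n * t) * \<Lambda> (bump x (4 * (2 ^ n * t)))"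
      using elim t by (intro bump_lipschitz) auto
    also have "\<Lambda> (bump x (4 * (2 ^ n * t))) = q ^ (n + 2) * \<Lambda> (bump x t)"
      using it[OF x, of "n + 2"] by (simp add: mult.assoc)
    \<comment> \<open>Both sides grow like q^n, while the relative displacement decays like 2^-n;
      after cancelling q^n only that decay remains.\<close>
    also have "8 * dist x y / (2 ^ n * t) * (q ^ (n + 2) * \<Lambda> (bump x t)) = q ^ n * (?c * (1/2) ^ n)"
      by (simp add: power_add power_one_over power2_eq_square mult_ac)
    also have "\<Lambda> (bump x (2 ^ n * t)) - \<Lambda> (bump y (2 ^ n * t)) = q ^ n * (\<Lambda> (bump x t) - \<Lambda> (bump y t))"
      by (simp only: it[OF x] it[OF y] right_diff_distrib)
    also have "\<bar>\<dots>\<bar> = q ^ n * \<bar>\<Lambda> (bump x t) - \<Lambda> (bump y t)\<bar>"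
      using q by (simp add: abs_mult)
    finally show ?case using q by (subst (asm) mult_le_cancel_left_pos) auto
  qed
  have "(\<lambda>n. ?c * (1/2) ^ n) \<longlonglongrightarrow> ?c * 0"
    by (intro tendsto_mult tendsto_const LIMSEQ_realpow_zero) auto
  then have "\<bar>\<Lambda> (bump x t) - \<Lambda> (bump y t)\<bar> \<le> ?c * 0"
    by (rule tendsto_lowerbound[OF _ ev]) simp
  then show ?thesis by simp
qed

end

subsection \<open>Uniform functionals and their blow-ups\<close>

text \<open>The mass function \<open>h\<close> is a parameter, so that all blow-ups of one
  functional share it and the dimension of their supports can be minimised within one class. Only
  its dyadic scaling is known; it need not be a power of t.\<close>

locale uniform_functional = pos_functional \<Lambda> for \<Lambda> :: "('a::euclidean_space \<Rightarrow> real) \<Rightarrow> real" +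
  fixes s :: real and h :: "real \<Rightarrow> real"
  assumes uniform: "x \<in> supp \<Longrightarrow> t > 0 \<Longrightarrow> \<Lambda> (bump x t) = h t"
    and h_pos: "t > 0 \<Longrightarrow> 0 < h t"
    and h_double: "t > 0 \<Longrightarrow> h (2 * t) = 2 powr s * h t"
begin

lemma h_power: "t > 0 \<Longrightarrow> h (2 ^ n * t) = (2 powr s) ^ n * h t"
proof (induction n)
  case (Suc n)
  then show ?case using h_double[of "2 ^ n * t"] by (simp add: mult.assoc)
qed simp

text \<open>Dilation by 2^n about \<open>a\<close>, with masses multiplied by 2^(ns), preserves
  \<open>h\<close> exactly, which gives both the bounds for compactness and the uniformity of the
  limit. The last clause is the only link to the original support: each limit point is approached by
  dilated support points at arbitrarily fine scales.\<close>

lemma blow_up: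
  assumes a: "a \<in> supp"
  shows "\<exists>L :: ('a \<Rightarrow> real) \<Rightarrow> real. uniform_functional L s h \<and> 0 \<in> pos_functional.supp L \<and>
    (\<forall>z\<in>pos_functional.supp L. \<forall>\<epsilon>>0. \<forall>N. \<exists>n\<ge>N. \<exists>y\<in>supp. dist z (2 ^ n *\<^sub>R (y - a)) < \<epsilon>)"
proof -
  define q :: real where "q = 2 powr s"
  have q: "q > 0" by (simp add: q_def)
  define M where "M = (\<lambda>n f. q ^ n * \<Lambda> (\<lambda>y. f ((2::real) ^ n *\<^sub>R (y - a))))"
  have aff: "(\<lambda>y. f ((2::real) ^ n *\<^sub>R (y - a))) \<in> Cc" if "f \<in> Cc" for f :: "'a \<Rightarrow> real" and n
    using that by (intro Cc_affine) auto
  have pos: "pos_functional (M n)" for n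
  proof
    fix f g :: "'a \<Rightarrow> real" assume "f \<in> Cc" "g \<in> Cc"
    then show "M n (\<lambda>x. f x + g x) = M n f + M n g"
      unfolding M_def by (subst add) (auto intro: aff simp: distrib_left)
  next
    fix f :: "'a \<Rightarrow> real" and c assume "f \<in> Cc"
    then show "M n (\<lambda>x. c * f x) = c * M n f" unfolding M_def by (subst scale) (auto intro: aff)
  next
    fix f :: "'a \<Rightarrow> real" assume "f \<in> Cc" "\<And>x. 0 \<le> f x"
    then show "0 \<le> M n f" unfolding M_def using q nonneg[OF aff] by simp
  qed
  have Mbump: "M n (bump (2 ^ n *\<^sub>R (y - a)) t) = h t" if "y \<in> supp" "t > 0" for n y t
  proof -
    have "M n (bump (2 ^ n *\<^sub>R (y - a)) t) = q ^ n * \<Lambda> (bump y (t / 2 ^ n))"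
      unfolding M_def by (subst bump_affine) auto
    also have "\<dots> = q ^ n * h (t / 2 ^ n)" using that by (simp add: uniform)
    also have "\<dots> = h t" using h_power[of "t / 2 ^ n" n] that by (simp add: q_def)
    finally show ?thesis .
  qed
  have M0: "M n (bump 0 t) = h t" if "t > 0" for n t using Mbump[OF a that, of n] by simp
  have "\<exists>C. \<forall>n. M n (bump 0 t) \<le> C" if "t > 0" for t using M0[OF that] by auto
  from pos_functional_cluster[of M, OF pos this]
  obtain F L where F: "F \<noteq> bot" "F \<le> sequentially" "pos_functional L"
    "\<And>f. f \<in> Cc \<Longrightarrow> ((\<lambda>n. M n f) \<longlongrightarrow> L f) F" by blast
  interpret L: pos_functional L by (rule F)
  \<comment> \<open>If no dilated support point were near \<open>z\<close>, the bump at
    \<open>z\<close> would vanish on the whole dilated support and have mass zero.\<close>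
  have near: "eventually (\<lambda>n. \<exists>y\<in>supp. dist z (2 ^ n *\<^sub>R (y - a)) < \<epsilon>) F" if z: "z \<in> L.supp" and e: "\<epsilon> > 0" for z \<epsilon>
  proof -
    have "0 < L (bump z \<epsilon>)" using z e by (simp add: L.supp_def)
    then have "eventually (\<lambda>n. 0 < M n (bump z \<epsilon>)) F"
      using order_tendstoD(1)[OF F(4)[OF bump_Cc[OF e]]] by simp
    then show ?thesis
    proof eventually_elim
      case (elim n)
      show ?case
      proof (rule ccontr)
        assume "\<not> ?case"
        then have "\<Lambda> (\<lambda>y. bump z \<epsilon> (2 ^ n *\<^sub>R (y - a))) = 0"
          using e by (intro null_supp aff bump_Cc) (auto simp: bump_eq_0 not_less)
        then show False using elim by (simp add: M_def)
      qed
    qed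
  qed
  \<comment> \<open>A limit point need not be a dilated support point, so its bump is compared with
    that of a nearby one. The limit along \<open>F\<close> is taken first, with \<epsilon> fixed;
    then \<epsilon> tends to 0.\<close>
  have Lh: "L (bump z t) = h t" if z: "z \<in> L.supp" and t: "t > 0" for z t
  proof -
    have L4: "((\<lambda>n. M n (bump z (4 * t))) \<longlongrightarrow> L (bump z (4 * t))) F" using t by (intro F bump_Cc) auto
    have "\<bar>L (bump z t) - h t\<bar> \<le> 8 * \<epsilon> / t * L (bump z (4 * t))" if e: "\<epsilon> > 0" "\<epsilon> \<le> t" for \<epsilon>
    proof (rule tendsto_le[OF F(1)])
      show "((\<lambda>n. \<bar>M n (bump z t) - h t\<bar>) \<longlongrightarrow> \<bar>L (bump z t) - h t\<bar>) F"
        using t by (intro tendsto_intros F bump_Cc)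
      show "((\<lambda>n. 8 * \<epsilon> / t * M n (bump z (4 * t))) \<longlongrightarrow> 8 * \<epsilon> / t * L (bump z (4 * t))) F"
        by (intro tendsto_mult L4 tendsto_const)
      show "eventually (\<lambda>n. \<bar>M n (bump z t) - h t\<bar> \<le> 8 * \<epsilon> / t * M n (bump z (4 * t))) F"
        using near[OF z e(1)]
      proof eventually_elim
        case (elim n)
        then obtain y where y: "y \<in> supp" "dist z (2 ^ n *\<^sub>R (y - a)) < \<epsilon>" by blast
        have "\<bar>M n (bump z t) - M n (bump (2 ^ n *\<^sub>R (y - a)) t)\<bar>
          \<le> 8 * dist z (2 ^ n *\<^sub>R (y - a)) / t * M n (bump z (4 * t))"
          using y e t by (intro pos_functional.bump_lipschitz pos) auto
        also have "\<dots> \<le> 8 * \<epsilon> / t * M n (bump z (4 * t))"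
          using y t pos_functional.bump_nonneg[OF pos, of "4 * t" n z]
          by (intro mult_right_mono divide_right_mono) auto
        finally show ?case using Mbump[OF y(1) t] by simp
      qed
    qed
    then have ev: "eventually (\<lambda>\<epsilon>. \<bar>L (bump z t) - h t\<bar> \<le> 8 * \<epsilon> / t * L (bump z (4 * t))) (at_right 0)"
      using t by (intro eventually_at_rightI[of 0 t]) auto
    have "((\<lambda>\<epsilon>. 8 * \<epsilon> / t * L (bump z (4 * t))) \<longlongrightarrow> 8 * 0 / t * L (bump z (4 * t))) (at_right 0)"
      using t by (intro tendsto_intros) auto
    from tendsto_lowerbound[OF this ev] show ?thesis by simp
  qed
  have u: "uniform_functional L s h" using Lh h_pos h_double by unfold_locales
  have z: "0 \<in> L.supp"
  proof -
    have "L (bump 0 t) = h t" if "t > 0" for t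
    proof (rule tendsto_unique[OF F(1)])
      show "((\<lambda>n. M n (bump 0 t)) \<longlongrightarrow> L (bump 0 t)) F" by (intro F bump_Cc that)
      show "((\<lambda>n. M n (bump 0 t)) \<longlongrightarrow> h t) F" using M0[OF that] by simp
    qed
    then show ?thesis using h_pos by (simp add: L.supp_def)
  qed
  have n: "\<exists>n\<ge>N. \<exists>y\<in>supp. dist z (2 ^ n *\<^sub>R (y - a)) < \<epsilon>" if "z \<in> L.supp" "\<epsilon> > 0" for z \<epsilon> N
  proof -
    have "eventually (\<lambda>n. n \<ge> N) F" by (rule filter_leD[OF F(2) eventually_ge_at_top])
    with near[OF that] have "eventually (\<lambda>n. n \<ge> N \<and> (\<exists>y\<in>supp. dist z (2 ^ n *\<^sub>R (y - a)) < \<epsilon>)) F"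
      by eventually_elim auto
    from eventually_happens'[OF F(1) this] show ?thesis by blast
  qed
  show ?thesis using u z n by blast
qed

end

text \<open>Constants do not affect exponential growth rates, so crude packing and covering bounds
  will suffice.\<close>

lemma base_le_of_power_le:
  fixes a b C D :: real
  assumes "C > 0" "a > 0" "b > 0" and le: "\<And>n. C * a ^ n \<le> D * b ^ n"
  shows "a \<le> b"
proof (rule ccontr)
  assume "\<not> a \<le> b"
  then have "1 < a / b" using assms by simp
  then obtain n where "D / C < (a / b) ^ n" using real_arch_pow by blast
  then have "D * b ^ n < C * a ^ n" using assms by (simp add: field_simps power_divide)
  with le[of n] show False by simp
qed

text \<open>The function (max 0 p)^2 has derivative 2 max 0 p, which is 2-Lipschitz, so the
  first-order Taylor remainder is at most the squared increment. It is applied to the kernel as a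
  function of the squared distance.\<close>

lemma quadratic_taylor:
  fixes p q :: real
  shows "\<bar>(max 0 q)\<^sup>2 - (max 0 p)\<^sup>2 - 2 * max 0 p * (q - p)\<bar> \<le> (q - p)\<^sup>2"
proof -
  consider "0 \<le> p" "0 \<le> q" | "0 \<le> p" "q < 0" | "p < 0" "0 \<le> q" | "p < 0" "q < 0" by linarith
  then show ?thesis
  proof cases
    case 1
    then have "(max 0 q)\<^sup>2 - (max 0 p)\<^sup>2 - 2 * max 0 p * (q - p) = (q - p)\<^sup>2"
      by (simp add: power2_eq_square algebra_simps)
    then show ?thesis by simp
  next
    case 2
    then have "(max 0 q)\<^sup>2 - (max 0 p)\<^sup>2 - 2 * max 0 p * (q - p) = (q - p)\<^sup>2 - q\<^sup>2"
      by (simp add: power2_eq_square algebra_simps)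
    moreover have "q\<^sup>2 \<le> (q - p)\<^sup>2" using 2 by (subst abs_le_square_iff[symmetric]) auto
    ultimately show ?thesis by (simp add: abs_le_iff)
  next
    case 3
    then have "q\<^sup>2 \<le> (q - p)\<^sup>2" by (intro power_mono) auto
    then show ?thesis using 3 by simp
  next
    case 4 then show ?thesis by simp
  qed
qed

section \<open>Exponent versus dimension, and the first moment\<close>

context uniform_functional begin

text \<open>Balls around the points of a lattice of mesh 1 in \<open>V\<close>: radius \<open>1/2\<close> gives a packing and
  large radius a covering.\<close>

lemma dim_eq_exponent:
  assumes V: "supp = V" "subspace V"
  shows "s = real (dim V)"
proof -
  obtain B where B: "B \<subseteq> V" "pairwise orthogonal B" "\<And>x. x \<in> B \<Longrightarrow> norm x = 1"
    "independent B" "card B = dim V" "span B = V"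
    using orthonormal_basis_subspace[OF V(2)] by blast
  have finB: "finite B" using B(4) by (rule finiteI_independent)
  define k where "k = dim V"
  define lat :: "('a \<Rightarrow> nat) \<Rightarrow> 'a" where "lat = (\<lambda>m. \<Sum>b\<in>B. real (m b) *\<^sub>R b)"
  define Q where "Q = (\<lambda>n. Pi\<^sub>E B (\<lambda>_. {..<(2::nat) ^ n}))"
  define q :: real where "q = 2 powr s"
  have q: "q > 0" by (simp add: q_def)
  have cardQ: "card (Q n) = (2 ^ k) ^ n" for n
    unfolding Q_def using B(5) finB by (simp add: card_PiE k_def power_mult[symmetric] mult.commute)
  have finQ: "finite (Q n)" for n unfolding Q_def using finB by (intro finite_PiE) auto
  have coord: "(\<Sum>b\<in>B. c b *\<^sub>R b) \<bullet> b' = c b'" if "b' \<in> B" for c b'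
  proof -
    have "(\<Sum>b\<in>B. c b *\<^sub>R b) \<bullet> b' = (\<Sum>b\<in>B. if b = b' then c b else 0)"
      unfolding inner_sum_left
    proof (intro sum.cong refl)
      fix b assume b: "b \<in> B"
      show "(c b *\<^sub>R b) \<bullet> b' = (if b = b' then c b else 0)"
      proof (cases "b = b'")
        case True then show ?thesis using B(3)[OF b] by (simp add: dot_square_norm)
      next
        case False
        then have "b \<bullet> b' = 0" using B(2) b that by (auto simp: pairwise_def orthogonal_def)
        with False show ?thesis by simp
      qed
    qed
    then show ?thesis using finB that by simp
  qed
  have expand: "y = (\<Sum>b\<in>B. (y \<bullet> b) *\<^sub>R b)" if "y \<in> V" for y
  proof -
    have "y \<in> range (\<lambda>c. \<Sum>b\<in>B. c b *\<^sub>R b)"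
      using that span_finite[OF finB] B(6) by simp
    then obtain c where c: "y = (\<Sum>b\<in>B. c b *\<^sub>R b)" by (rule rangeE)
    then have "y \<bullet> b = c b" if "b \<in> B" for b using coord[OF that] by simp
    then have "(\<Sum>b\<in>B. (y \<bullet> b) *\<^sub>R b) = (\<Sum>b\<in>B. c b *\<^sub>R b)" by (intro sum.cong) auto
    then show ?thesis using c by simp
  qed
  have norm_sum: "norm (\<Sum>b\<in>B. c b *\<^sub>R b) \<le> real k * r" if "\<And>b. b \<in> B \<Longrightarrow> \<bar>c b\<bar> \<le> r" for c r
  proof -
    have "norm (\<Sum>b\<in>B. c b *\<^sub>R b) \<le> (\<Sum>b\<in>B. r)"
      using that B(3) by (intro sum_norm_le) auto
    then show ?thesis by (simp add: B(5) k_def)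
  qed
  have latV: "lat m \<in> V" for m
    unfolding lat_def using B(1) V(2) by (intro subspace_sum subspace_scale) auto
  have Llat: "\<Lambda> (bump (lat m) t) = h t" if "t > 0" for m t using latV V that by (intro uniform) auto
  have V0: "0 \<in> V" using V(2) by (rule subspace_0)
  \<comment> \<open>Half of \<open>t\<close> is k + 1: enough to cover rounding to the lattice,
    which moves a point by at most k, and enough for 2^n t / 2 to bound the norm of every point
    within 1/2 of the lattice cube.\<close>
  define t where "t = 2 * real k + 2"
  have t: "t > 0" by (simp add: t_def)

  \<comment> \<open>Packing: distinct lattice points are at distance at least 1, so at most one bump
    of radius 1/2 is positive at any point.\<close>
  have "h (1/2) * (2 ^ k) ^ n \<le> (2 * h t) * q ^ n" for n
  proof -
    have le: "(\<Sum>m\<in>Q n. bump (lat m) (1/2) y) \<le> 2 * bump 0 (2 ^ n * t) y" for y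
    proof (cases "\<exists>m\<in>Q n. dist (lat m) y < 1/2")
      case False
      then have "(\<Sum>m\<in>Q n. bump (lat m) (1/2) y) = 0"
        by (intro sum.neutral ballI) (auto simp: bump_eq_0 not_less)
      then show ?thesis by simp
    next
      case True
      then obtain m where m: "m \<in> Q n" "dist (lat m) y < 1/2" by blast
      have "bump (lat m') (1/2) y = 0" if m': "m' \<in> Q n" "m' \<noteq> m" for m'
      proof (rule ccontr)
        assume "bump (lat m') (1/2) y \<noteq> 0"
        then have "dist (lat m') y < 1/2" by (auto simp: bump_eq_0)
        then have d: "norm (lat m - lat m') < 1"
          using m(2) dist_triangle2[of "lat m" "lat m'" y] by (simp add: dist_norm)
        have "\<exists>b\<in>B. m b \<noteq> m' b"
        proof (rule ccontr)
          assume "\<not> ?thesis"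
          then have "m' = m" using m(1) m'(1) unfolding Q_def by (intro PiE_ext) auto
          then show False using m'(2) by contradiction
        qed
        then obtain b where b: "b \<in> B" "m b \<noteq> m' b" by blast
        have "real (m b) - real (m' b) = (lat m - lat m') \<bullet> b"
          using coord[OF b(1)] by (simp add: lat_def inner_diff_left)
        then have "\<bar>real (m b) - real (m' b)\<bar> < 1"
          using Cauchy_Schwarz_ineq2[of "lat m - lat m'" b] B(3)[OF b(1)] d by simp
        with b(2) show False by linarith
      qed
      then have "(\<Sum>m\<in>Q n. bump (lat m) (1/2) y) = bump (lat m) (1/2) y"
        using m(1) finQ by (subst sum.remove[of _ m]) (auto intro: sum.neutral)
      also have "\<dots> \<le> 1" by (rule bump_le_one)
      also have "\<dots> \<le> 2 * bump 0 (2 ^ n * t) y"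
      proof -
        have "norm (lat m) \<le> real k * 2 ^ n"
          unfolding lat_def
        proof (rule norm_sum)
          fix b assume "b \<in> B"
          then have "m b < 2 ^ n" using m(1) by (auto simp: Q_def)
          then have "real (m b) < real (2 ^ n)" by (simp only: of_nat_less_iff)
          then show "\<bar>real (m b)\<bar> \<le> 2 ^ n" by simp
        qed
        then have "norm y \<le> real k * 2 ^ n + 1/2"
          using m(2) norm_triangle_sub[of y "lat m"] by (simp add: dist_norm norm_minus_commute)
        also have "\<dots> \<le> real k * 2 ^ n + 2 ^ n" using one_le_power[of "2::real" n] by linarith
        also have "\<dots> = 2 ^ n * t / 2" by (simp add: t_def algebra_simps)
        finally have "1/2 \<le> bump 0 (2 ^ n * t) y" using t by (intro bump_ge_half) (auto simp: dist_norm)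
        then show ?thesis by simp
      qed
      finally show ?thesis .
    qed
    have "real (card (Q n)) * h (1/2) = \<Lambda> (\<lambda>y. \<Sum>m\<in>Q n. bump (lat m) (1/2) y)"
      using finQ by (subst sum) (auto simp: Llat bump_Cc)
    also have "\<dots> \<le> \<Lambda> (\<lambda>y. 2 * bump 0 (2 ^ n * t) y)"
      using le t finQ by (intro mono Cc_sum Cc_scale bump_Cc) auto
    also have "\<dots> = 2 * h (2 ^ n * t)" using t V0 V by (subst scale) (auto simp: bump_Cc uniform)
    also have "\<dots> = 2 * h t * q ^ n" using h_power[OF t] by (simp add: q_def)
    finally show ?thesis by (simp add: cardQ mult.commute)
  qed
  then have 1: "2 ^ k \<le> q" by (rule base_le_of_power_le[rotated 3]) (use h_pos q in simp_all)

  have "h 1 * q ^ n \<le> (2 * 2 ^ k * h t) * (2 ^ k) ^ n" for n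
  proof -
    \<comment> \<open>Covering: \<open>c\<close> is the centre of the cube of side 2^(n+1), so every
      point of \<open>V\<close> in its 2^n-ball has positive coordinates below that side and rounds
      down to an index in \<open>Q (Suc n)\<close>.\<close>
    define c where "c = (\<Sum>b\<in>B. (2::real) ^ n *\<^sub>R b)"
    have cV: "c \<in> V" unfolding c_def using B(1) V(2) by (intro subspace_sum subspace_scale) auto
    have le: "bump c (2 ^ n) y \<le> 2 * (\<Sum>m\<in>Q (Suc n). bump (lat m) t y)" if y: "y \<in> V" for y
    proof (cases "dist c y < 2 ^ n")
      case False
      then have "bump c (2 ^ n) y = 0" by (simp add: bump_eq_0)
      then show ?thesis by (simp add: sum_nonneg)
    next
      case True
      have yb: "0 < y \<bullet> b \<and> y \<bullet> b < 2 ^ Suc n" if b: "b \<in> B" for b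
      proof -
        have "\<bar>(y - c) \<bullet> b\<bar> < 2 ^ n"
          using Cauchy_Schwarz_ineq2[of "y - c" b] B(3)[OF b] True by (simp add: dist_norm norm_minus_commute)
        moreover have "c \<bullet> b = 2 ^ n" unfolding c_def by (rule coord[OF b])
        ultimately show ?thesis by (simp add: inner_diff_left abs_less_iff)
      qed
      define m where "m = restrict (\<lambda>b. nat \<lfloor>y \<bullet> b\<rfloor>) B"
      have mb: "real (m b) \<le> y \<bullet> b \<and> y \<bullet> b < real (m b) + 1" if "b \<in> B" for b
        using yb[OF that] that by (auto simp: m_def)
      have "m b < 2 ^ Suc n" if "b \<in> B" for b
      proof -
        have "real (m b) < real (2 ^ Suc n)" using mb[OF that] yb[OF that] by simp
        then show ?thesis by (simp only: of_nat_less_iff)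
      qed
      then have mQ: "m \<in> Q (Suc n)" by (auto simp: Q_def m_def PiE_iff)
      have "y - lat m = (\<Sum>b\<in>B. (y \<bullet> b - real (m b)) *\<^sub>R b)"
        using expand[OF y] by (simp add: lat_def scaleR_diff_left sum_subtractf)
      also have "norm \<dots> \<le> real k * 1" using mb by (intro norm_sum) (force simp: abs_le_iff)
      finally have "dist (lat m) y \<le> t / 2" by (simp add: dist_norm norm_minus_commute t_def)
      then have "1/2 \<le> bump (lat m) t y" using t by (intro bump_ge_half)
      also have "\<dots> \<le> (\<Sum>m\<in>Q (Suc n). bump (lat m) t y)"
        using mQ finQ by (intro member_le_sum) auto
      finally show ?thesis using bump_le_one[of c "2 ^ n" y] by simp
    qed
    have "h 1 * q ^ n = \<Lambda> (bump c (2 ^ n))"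
      using cV V h_power[of 1 n] by (simp add: uniform q_def)
    also have "\<dots> \<le> \<Lambda> (\<lambda>y. 2 * (\<Sum>m\<in>Q (Suc n). bump (lat m) t y))"
      using le V t finQ by (intro mono_supp Cc_sum Cc_scale bump_Cc) auto
    also have "\<dots> = 2 * (\<Sum>m\<in>Q (Suc n). h t)"
      using t finQ by (subst scale) (auto intro!: Cc_sum bump_Cc simp: sum Llat bump_Cc)
    also have "\<dots> = (2 * 2 ^ k * h t) * (2 ^ k) ^ n" using cardQ[of "Suc n"] by simp
    finally show ?thesis .
  qed
  then have 2: "q \<le> 2 ^ k" by (rule base_le_of_power_le[rotated 3]) (use h_pos q in simp_all)
  from 1 2 have "2 powr s = 2 powr real k" by (simp add: q_def powr_realpow)
  then show ?thesis by (simp add: k_def powr_inj)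
qed

text \<open>This is the pairing of \<open>z\<close> with the first moment of the measure weighted by
  \<open>bump1\<close>. Up to the factor 4 / T^2 it is the derivative at 0, in direction
  \<open>z\<close>, of the mass of a bump with moving centre.\<close>

definition moment :: "real \<Rightarrow> 'a \<Rightarrow> real" where
  "moment T z = \<Lambda> (\<lambda>y. (y \<bullet> z) * bump1 T y)"

lemma moment_Cc: "T > 0 \<Longrightarrow> (\<lambda>y. (y \<bullet> z) * bump1 T y) \<in> Cc"
  by (intro Cc_mult_continuous bump1_Cc) (auto intro!: continuous_intros)

lemma linear_moment: "T > 0 \<Longrightarrow> linear (moment T)"
proof (rule linearI)
  assume T: "T > 0"
  show "moment T (x + y) = moment T x + moment T y" for x y
    unfolding moment_def using T by (subst add[symmetric]) (auto intro: moment_Cc simp: inner_add_right algebra_simps)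
  show "moment T (c *\<^sub>R x) = c *\<^sub>R moment T x" for c x
  proof -
    have "moment T (c *\<^sub>R x) = \<Lambda> (\<lambda>y. c * ((y \<bullet> x) * bump1 T y))" by (simp add: moment_def mult.assoc)
    then show ?thesis using T by (simp add: moment_def scale moment_Cc)
  qed
qed

text \<open>Second order expansion in \<open>y\<close> of the identity \<open>\<Lambda> (bump y T) = \<Lambda> (bump 0 T)\<close>.\<close>

lemma moment_quadratic:
  assumes z: "0 \<in> supp" and T: "T > 0"
  obtains C where "C > 0" "\<And>y. y \<in> supp \<Longrightarrow> norm y \<le> T \<Longrightarrow> \<bar>moment T y\<bar> \<le> C * (norm y)\<^sup>2"
proof -
  \<comment> \<open>The expansion below gives 2 |y|^2 times the mass of \<open>bump1\<close> and 50
    |y|^2 times \<open>h (4 * T)\<close>; both are divided by the 4 in front of the moment.\<close>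
  let ?C = "\<Lambda> (bump1 T) / 2 + 25 / 2 * h (4 * T)"
  have A: "0 \<le> \<Lambda> (bump1 T)" using T by (intro nonneg bump1_Cc) auto
  have "\<bar>moment T y\<bar> \<le> ?C * (norm y)\<^sup>2" if y: "y \<in> supp" "norm y \<le> T" for y
  proof -
    \<comment> \<open>\<open>D x\<close> is the decrease of the squared relative distance when the
      centre moves from 0 to \<open>y\<close>, and \<open>E x\<close> is the resulting linear Taylor
      term.\<close>
    define D where "D = (\<lambda>x. (2 * (x \<bullet> y) - (norm y)\<^sup>2) / T\<^sup>2)"
    define E where "E = (\<lambda>x. 4 / T\<^sup>2 * ((x \<bullet> y) * bump1 T x) - 2 * (norm y)\<^sup>2 / T\<^sup>2 * bump1 T x)"
    have E: "E x = 2 * bump1 T x * D x" for x by (simp add: E_def D_def diff_divide_distrib right_diff_distrib mult_ac)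
    have ECc: "E \<in> Cc" unfolding E_def using T by (intro Cc_diff Cc_scale moment_Cc bump1_Cc)
    have LE: "\<Lambda> E = 4 / T\<^sup>2 * moment T y - 2 * (norm y)\<^sup>2 / T\<^sup>2 * \<Lambda> (bump1 T)"
    proof -
      have "\<Lambda> E = \<Lambda> (\<lambda>x. 4 / T\<^sup>2 * ((x \<bullet> y) * bump1 T x)) - \<Lambda> (\<lambda>x. 2 * (norm y)\<^sup>2 / T\<^sup>2 * bump1 T x)"
        unfolding E_def using T by (intro diff Cc_scale moment_Cc bump1_Cc)
      also have "\<Lambda> (\<lambda>x. 4 / T\<^sup>2 * ((x \<bullet> y) * bump1 T x)) = 4 / T\<^sup>2 * moment T y"
        unfolding moment_def using T by (intro scale moment_Cc)
      also have "\<Lambda> (\<lambda>x. 2 * (norm y)\<^sup>2 / T\<^sup>2 * bump1 T x) = 2 * (norm y)\<^sup>2 / T\<^sup>2 * \<Lambda> (bump1 T)"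
        using T by (intro scale bump1_Cc)
      finally show ?thesis .
    qed
    \<comment> \<open>Within 2T the bump of radius 4T is at least 1/2 and |D| is at most 5 |y| / T,
      hence 50, twice 25; outside, both kernels and \<open>E\<close> vanish.\<close>
    have le: "\<bar>bump y T x - bump 0 T x - E x\<bar> \<le> 50 * (norm y)\<^sup>2 / T\<^sup>2 * bump 0 (4 * T) x" for x
    proof (cases "norm x \<le> 2 * T")
      case True
      have "(norm (x - y) / T)\<^sup>2 = (norm x / T)\<^sup>2 - D x"
      proof -
        have "(norm (x - y))\<^sup>2 = (norm x)\<^sup>2 - (2 * (x \<bullet> y) - (norm y)\<^sup>2)"
          by (simp add: power2_norm_eq_inner algebra_simps inner_commute)
        then show ?thesis by (simp add: D_def power_divide diff_divide_distrib)
      qed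
      then have "\<bar>bump y T x - bump 0 T x - E x\<bar> \<le> (D x)\<^sup>2"
        using quadratic_taylor[of "1 - (norm (x - y) / T)\<^sup>2" "1 - (norm x / T)\<^sup>2"]
        by (simp add: bump_def bump1_def E)
      also have "(D x)\<^sup>2 \<le> (5 * norm y / T)\<^sup>2"
      proof (rule power2_le_iff_abs_le[THEN iffD2])
        have "\<bar>2 * (x \<bullet> y) - (norm y)\<^sup>2\<bar> \<le> 2 * (norm x * norm y) + norm y * norm y"
          using Cauchy_Schwarz_ineq2[of x y] zero_le_square[of "norm y"]
          unfolding power2_eq_square by linarith
        also have "\<dots> \<le> 2 * (2 * T * norm y) + T * norm y"
          using True y(2) T by (intro add_mono mult_mono) auto
        finally have "\<bar>2 * (x \<bullet> y) - (norm y)\<^sup>2\<bar> / T\<^sup>2 \<le> 5 * T * norm y / T\<^sup>2" by (intro divide_right_mono) auto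
        then show "\<bar>D x\<bar> \<le> 5 * norm y / T" using T by (simp add: D_def power2_eq_square)
      qed (use T in auto)
      also have "\<dots> = 50 * (norm y)\<^sup>2 / T\<^sup>2 * (1/2)" by (simp add: power_divide power_mult_distrib)
      also have "\<dots> \<le> 50 * (norm y)\<^sup>2 / T\<^sup>2 * bump 0 (4 * T) x"
        using T True by (intro mult_left_mono bump_ge_half) (auto simp: dist_norm)
      finally show ?thesis .
    next
      case False
      then have "T \<le> norm x" "T \<le> norm (x - y)" using y(2) T norm_triangle_ineq2[of x y] by auto
      then have "bump1 T x = 0" "bump1 T (x - y) = 0" using T by (simp_all add: bump1_eq_0)
      then show ?thesis by (simp add: bump_def E)
    qed
    have "\<bar>\<Lambda> (\<lambda>x. bump y T x - bump 0 T x - E x)\<bar> \<le> \<Lambda> (\<lambda>x. 50 * (norm y)\<^sup>2 / T\<^sup>2 * bump 0 (4 * T) x)"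
      using T ECc le by (intro abs_le Cc_diff Cc_scale bump_Cc) auto
    also have "\<dots> = 50 * (norm y)\<^sup>2 / T\<^sup>2 * \<Lambda> (bump 0 (4 * T))" using T by (intro scale bump_Cc) auto
    also have "\<Lambda> (bump 0 (4 * T)) = h (4 * T)" using z T by (intro uniform) auto
    also have "\<Lambda> (\<lambda>x. bump y T x - bump 0 T x - E x) = \<Lambda> (bump y T) - \<Lambda> (bump 0 T) - \<Lambda> E"
      using T ECc by (simp add: diff Cc_diff bump_Cc)
    \<comment> \<open>Equal masses at the two support points cancel, which forces the linear term
      itself to be of second order.\<close>
    also have "\<dots> = - \<Lambda> E" using y z T by (simp add: uniform)
    finally have "\<bar>\<Lambda> E\<bar> \<le> 50 * (norm y)\<^sup>2 / T\<^sup>2 * h (4 * T)" by simp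
    then have "\<bar>T\<^sup>2 * \<Lambda> E\<bar> \<le> 50 * (norm y)\<^sup>2 * h (4 * T)"
      using T by (simp add: abs_mult field_simps)
    also have "T\<^sup>2 * \<Lambda> E = 4 * moment T y - 2 * (norm y)\<^sup>2 * \<Lambda> (bump1 T)"
      using T by (simp add: LE right_diff_distrib)
    finally have *: "\<bar>4 * moment T y - 2 * (norm y)\<^sup>2 * \<Lambda> (bump1 T)\<bar> \<le> 50 * (norm y)\<^sup>2 * h (4 * T)" .
    have "0 \<le> (norm y)\<^sup>2 * \<Lambda> (bump1 T)" using A by simp
    with * have "\<bar>moment T y\<bar> \<le> (norm y)\<^sup>2 * \<Lambda> (bump1 T) / 2 + 25 / 2 * ((norm y)\<^sup>2 * h (4 * T))"
      unfolding mult.assoc by linarith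
    also have "\<dots> = ?C * (norm y)\<^sup>2" by (simp add: field_simps)
    finally show ?thesis .
  qed
  moreover have "?C > 0" using A h_pos[of "4 * T"] T by simp
  ultimately show thesis using that by blast
qed

end

section \<open>Lowering the dimension of the support by blow-ups\<close>

lemma dim_kernel_less:
  fixes l :: "'a::euclidean_space \<Rightarrow> real"
  assumes "linear l" and S: "S \<subseteq> span V" "\<And>z. z \<in> S \<Longrightarrow> l z = 0" and e: "e \<in> span V" "l e \<noteq> 0"
  shows "dim S < dim V"
proof -
  have "subspace {z \<in> span V. l z = 0}"
    using assms(1) unfolding subspace_def
    by (auto simp: linear_0 linear_add linear_scale span_add span_scale span_0)
  then have "span S \<subseteq> {z \<in> span V. l z = 0}" using S by (intro span_minimal) auto
  then have "span S \<subset> span V" using e by auto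
  then show ?thesis by (rule dim_psubset)
qed

lemma approx_in_span:
  fixes a :: "'a::euclidean_space"
  assumes "a \<in> S" "\<And>\<epsilon>. \<epsilon> > 0 \<Longrightarrow> \<exists>n. \<exists>y\<in>S. dist z (2 ^ n *\<^sub>R (y - a)) < \<epsilon>"
  shows "z \<in> span S"
proof -
  have "z \<in> closure (span S)"
    unfolding closure_approachable
  proof (intro allI impI)
    fix \<epsilon> :: real assume "\<epsilon> > 0"
    then obtain n y where y: "y \<in> S" "dist z (2 ^ n *\<^sub>R (y - a)) < \<epsilon>" using assms(2) by blast
    have "2 ^ n *\<^sub>R (y - a) \<in> span S" using y assms(1) by (intro span_scale span_diff span_base)
    with y(2) show "\<exists>y\<in>span S. dist y z < \<epsilon>" by (auto simp: dist_commute)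
  qed
  then show ?thesis by (simp add: closed_span)
qed

lemma (in uniform_functional) exponent_integer:
  assumes "supp \<noteq> {}"
  shows "s \<in> \<int>"
proof -
  \<comment> \<open>The mass function is fixed and 0 is required in the support, so every blow-up
    below is again a competitor for the minimum.\<close>
  define P where "P = (\<lambda>m. \<exists>L :: ('a \<Rightarrow> real) \<Rightarrow> real. uniform_functional L s h \<and>
    0 \<in> pos_functional.supp L \<and> dim (pos_functional.supp L) = m)"
  obtain a where "a \<in> supp" using assms by blast
  then obtain L :: "('a \<Rightarrow> real) \<Rightarrow> real" where "uniform_functional L s h" "0 \<in> pos_functional.supp L"
    using blow_up[of a] by blast
  then have "\<exists>m. P m" unfolding P_def by blast
  then have "P (LEAST m. P m)" by (rule LeastI_ex)
  then obtain L :: "('a \<Rightarrow> real) \<Rightarrow> real" where L: "uniform_functional L s h"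
    "0 \<in> pos_functional.supp L" "dim (pos_functional.supp L) = (LEAST m. P m)"
    unfolding P_def by blast
  interpret L: uniform_functional L s h by (rule L)
  have minimal: "dim L.supp \<le> dim (pos_functional.supp M)"
    if "uniform_functional M s h" "0 \<in> pos_functional.supp M" for M :: "('a \<Rightarrow> real) \<Rightarrow> real"
  proof -
    have "P (dim (pos_functional.supp M))" unfolding P_def using that by blast
    then show ?thesis unfolding L(3) by (rule Least_le)
  qed
  show ?thesis
  proof (cases "L.supp = span L.supp")
    case True
    then have "s = real (dim (span L.supp))" by (rule L.dim_eq_exponent[OF _ subspace_span])
    then show ?thesis by simp
  next
    case False
    then obtain p where p: "p \<in> span L.supp" "p \<notin> L.supp" using span_superset by blast
    obtain a where a: "a \<in> L.supp" "\<And>y. y \<in> L.supp \<Longrightarrow> dist p a \<le> dist p y"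
      using distance_attains_inf[OF L.closed_supp, of p] L(2) by blast
    \<comment> \<open>The open ball about \<open>p\<close> through \<open>a\<close> misses the
      support, so \<open>e\<close> acts as an outward normal at \<open>a\<close>.\<close>
    define e where "e = p - a"
    have e: "e \<in> span L.supp" "e \<noteq> 0" using p a by (auto simp: e_def span_diff span_base)
    obtain M where M: "uniform_functional M s h" "0 \<in> pos_functional.supp M"
      "\<forall>z\<in>pos_functional.supp M. \<forall>\<epsilon>>0. \<forall>N. \<exists>n\<ge>N. \<exists>y\<in>L.supp. dist z (2 ^ n *\<^sub>R (y - a)) < \<epsilon>"
      using L.blow_up[OF a(1)] by blast
    interpret M: uniform_functional M s h by (rule M)
    have Mspan: "M.supp \<subseteq> span L.supp"
    proof
      fix z assume "z \<in> M.supp"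
      then show "z \<in> span L.supp" using M(3) by (intro approx_in_span[OF a(1)]) blast
    qed
    \<comment> \<open>The tangent ball gives 2 (y - a) . e at most |y - a|^2. For y - a = 2^-n w the
      right side is smaller by a further factor 2^-n, so the curvature disappears in the blow-up and
      a half space remains.\<close>
    have half: "z \<bullet> e \<le> 0" if z: "z \<in> M.supp" for z
    proof -
      have "z \<bullet> e \<le> (norm z + 1)\<^sup>2 * (1/2) ^ N + (1/2) ^ N * norm e" for N :: nat
      proof -
        obtain n y where y: "n \<ge> N" "y \<in> L.supp" "dist z (2 ^ n *\<^sub>R (y - a)) < (1/2) ^ N"
          using bspec[OF M(3) z, rule_format, of "(1/2)^N" N] by auto
        define w where "w = 2 ^ n *\<^sub>R (y - a)"
        have yw: "y - a = (1/2) ^ n *\<^sub>R w" by (simp add: w_def power_one_over)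
        have "(norm e)\<^sup>2 \<le> (norm (e - (y - a)))\<^sup>2"
          using a(2)[OF y(2)] by (intro power_mono) (auto simp: dist_norm e_def algebra_simps)
        then have "2 * ((y - a) \<bullet> e) \<le> (norm (y - a))\<^sup>2"
          by (simp add: power2_norm_eq_inner algebra_simps inner_commute)
        then have "2 * ((1/2) ^ n * (w \<bullet> e)) \<le> ((1/2) ^ n)\<^sup>2 * (norm w)\<^sup>2"
          unfolding yw by (simp add: power_mult_distrib)
        then have "(1/2) ^ n * (w \<bullet> e) \<le> (1/2) ^ n * ((1/2) ^ n * (norm w)\<^sup>2 / 2)"
          by (simp add: power2_eq_square)
        then have "w \<bullet> e \<le> (1/2) ^ n * (norm w)\<^sup>2 / 2" by (subst (asm) mult_le_cancel_left_pos) auto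
        also have "\<dots> \<le> (1/2) ^ N * (norm z + 1)\<^sup>2"
        proof -
          have "norm w \<le> norm z + 1"
            using y(3) norm_triangle_sub[of w z] power_le_one[of "1/2::real" N]
            by (simp add: w_def dist_norm norm_minus_commute)
          then have "(1/2) ^ n * (norm w)\<^sup>2 \<le> (1/2) ^ N * (norm z + 1)\<^sup>2"
            using y(1) by (intro mult_mono power_decreasing power_mono) auto
          then show ?thesis by (smt (verit) zero_le_mult_iff zero_le_power2 zero_le_power field_sum_of_halves)
        qed
        finally have "w \<bullet> e \<le> (1/2) ^ N * (norm z + 1)\<^sup>2" .
        moreover have "(z - w) \<bullet> e \<le> (1/2) ^ N * norm e"
        proof -
          have "(z - w) \<bullet> e \<le> norm (z - w) * norm e" by (rule norm_cauchy_schwarz)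
          also have "\<dots> \<le> (1/2) ^ N * norm e" using y(3) by (intro mult_right_mono) (auto simp: w_def dist_norm)
          finally show ?thesis .
        qed
        ultimately show ?thesis by (simp add: inner_diff_left mult.commute)
      qed
      then have "\<exists>N0. \<forall>N\<ge>N0. z \<bullet> e \<le> (norm z + 1)\<^sup>2 * (1/2) ^ N + (1/2) ^ N * norm e" by blast
      moreover have "(\<lambda>N. (norm z + 1)\<^sup>2 * (1/2) ^ N + (1/2) ^ N * norm e) \<longlonglongrightarrow> (norm z + 1)\<^sup>2 * 0 + 0 * norm e"
        by (intro tendsto_intros LIMSEQ_realpow_zero) auto
      ultimately have "z \<bullet> e \<le> (norm z + 1)\<^sup>2 * 0 + 0 * norm e" by (intro LIMSEQ_le_const)
      then show ?thesis by simp
    qed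
    \<comment> \<open>A support contained in the hyperplane orthogonal to \<open>e\<close> would
      have dimension below the minimum, so some point lies strictly inside the half space.\<close>
    have "\<exists>y0\<in>M.supp. y0 \<bullet> e < 0"
    proof (rule ccontr)
      assume "\<not> ?thesis"
      then have "\<And>z. z \<in> M.supp \<Longrightarrow> z \<bullet> e = 0" using half by force
      then have "dim M.supp < dim L.supp"
        using e Mspan by (intro dim_kernel_less[of "\<lambda>z. z \<bullet> e" _ _ e])
          (simp_all add: linear_iff inner_add_left)
      then show False using minimal[OF M(1,2)] by simp
    qed
    then obtain y0 where y0: "y0 \<in> M.supp" "y0 \<bullet> e < 0" by blast
    \<comment> \<open>The margin 1 puts \<open>y0\<close> strictly inside the ball of radius
      \<open>T\<close>, where \<open>bump1\<close> is positive.\<close>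
    define T where "T = norm y0 + 1"
    have T: "T > 0" "norm y0 < T" by (auto simp: T_def intro: add_nonneg_pos)
    \<comment> \<open>On the support the integrand is nowhere positive, and near \<open>y0\<close>
      it stays below half its negative value there; a bump at \<open>y0\<close>, of positive mass,
      makes the moment strictly negative.\<close>
    have neg: "M.moment T e < 0"
    proof (rule ccontr)
      assume nn: "\<not> M.moment T e < 0"
      let ?f = "\<lambda>y. (y \<bullet> e) * bump1 T y"
      have "continuous_on UNIV ?f" by (intro Cc_continuous M.moment_Cc T)
      then have op: "open {y. ?f y < ?f y0 / 2}"
        by (intro open_Collect_less continuous_on_const) 
      have fy0: "?f y0 < 0" using y0 T bump1_eq_0[of T y0] bump1_nonneg[of T y0]
        by (intro mult_neg_pos) linarith+
      have "y0 \<in> {y. ?f y < ?f y0 / 2}" using fy0 by simp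
      then obtain r where r: "r > 0" "ball y0 r \<subseteq> {y. ?f y < ?f y0 / 2}"
        using op open_contains_ball_eq by blast
      have "M ?f \<le> M (\<lambda>y. (?f y0 / 2) * bump y0 r y)"
      proof (intro M.mono_supp Cc_scale bump_Cc M.moment_Cc T r)
        fix y assume y: "y \<in> M.supp"
        show "?f y \<le> (?f y0 / 2) * bump y0 r y"
        proof (cases "dist y0 y < r")
          case True
          then have "?f y < ?f y0 / 2" using r(2) by (simp add: subset_eq)
          then have "?f y \<le> ?f y0 / 2 * 1" by simp
          also have "\<dots> \<le> (?f y0 / 2) * bump y0 r y"
            using fy0 bump_le_one by (intro mult_left_mono_neg) auto
          finally show ?thesis .
        next
          case False
          then have "bump y0 r y = 0" using r by (simp add: bump_eq_0)
          then show ?thesis using half[OF y] by (simp add: mult_nonpos_nonneg)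
        qed
      qed
      also have "\<dots> = (?f y0 / 2) * M (bump y0 r)" using r by (intro M.scale bump_Cc)
      also have "\<dots> < 0" using fy0 y0(1) r by (intro mult_neg_pos) (auto simp: M.supp_def)
      finally show False using nn by (simp add: M.moment_def)
    qed
    obtain C where C: "C > 0" "\<And>y. y \<in> M.supp \<Longrightarrow> norm y \<le> T \<Longrightarrow> \<bar>M.moment T y\<bar> \<le> C * (norm y)\<^sup>2"
      using M.moment_quadratic[OF M(2) T(1)] by blast
    \<comment> \<open>The second blow-up is at 0, where the quadratic bound on the moment is
      available.\<close>
    obtain K where K: "uniform_functional K s h" "0 \<in> pos_functional.supp K"
      "\<forall>z\<in>pos_functional.supp K. \<forall>\<epsilon>>0. \<forall>N. \<exists>n\<ge>N. \<exists>y\<in>M.supp. dist z (2 ^ n *\<^sub>R (y - 0)) < \<epsilon>"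
      using M.blow_up[OF M(2)] by blast
    interpret K: uniform_functional K s h by (rule K)
    have lin: "linear (M.moment T)" by (rule M.linear_moment[OF T(1)])
    obtain B where B: "B > 0" "\<And>x. \<bar>M.moment T x\<bar> \<le> B * norm x"
      using linear_bounded_pos[OF lin] by auto
    \<comment> \<open>The moment is linear while its bound on the support is quadratic: at y = 2^-n
      w they scale like 2^-n and 4^-n, so the moment vanishes at every blow-up point.
      \<open>N0\<close> brings y into the range where the bound holds.\<close>
    have null: "M.moment T z = 0" if z: "z \<in> K.supp" for z
    proof -
      obtain N0 :: nat where N0: "(norm z + 1) / T < 2 ^ N0" using real_arch_pow[of 2] by auto
      have "\<bar>M.moment T z\<bar> \<le> C * (norm z + 1)\<^sup>2 * (1/2) ^ N + B * (1/2) ^ N" if N: "N \<ge> N0" for N :: nat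
      proof -
        obtain n y where y: "n \<ge> N" "y \<in> M.supp" "dist z (2 ^ n *\<^sub>R y) < (1/2) ^ N"
          using bspec[OF K(3) z, rule_format, of "(1/2)^N" N] by auto
        define w where "w = 2 ^ n *\<^sub>R y"
        have yw: "y = (1/2) ^ n *\<^sub>R w" by (simp add: w_def power_one_over)
        have w: "norm w \<le> norm z + 1"
          using y(3) norm_triangle_sub[of w z] power_le_one[of "1/2::real" N]
          by (simp add: w_def dist_norm norm_minus_commute)
        have "norm y = (1/2) ^ n * norm w" by (simp add: yw)
        also have "\<dots> \<le> (1/2) ^ N0 * (norm z + 1)"
          using w N y(1) by (intro mult_mono power_decreasing) auto
        also have "\<dots> \<le> T" using N0 T(1) by (simp add: field_simps power_one_over)
        finally have "\<bar>M.moment T y\<bar> \<le> C * (norm y)\<^sup>2" by (intro C y)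
        then have "(1/2) ^ n * \<bar>M.moment T w\<bar> \<le> (1/2) ^ n * (C * (norm w)\<^sup>2 * (1/2) ^ n)"
          unfolding yw by (simp add: linear_scale[OF lin] abs_mult power_mult_distrib power2_eq_square mult_ac)
        then have "\<bar>M.moment T w\<bar> \<le> C * (norm w)\<^sup>2 * (1/2) ^ n" by (subst (asm) mult_le_cancel_left_pos) auto
        also have "\<dots> \<le> C * (norm z + 1)\<^sup>2 * (1/2) ^ N"
          using C(1) w y(1) by (intro mult_mono power_decreasing power_mono) auto
        finally have "\<bar>M.moment T w\<bar> \<le> C * (norm z + 1)\<^sup>2 * (1/2) ^ N" .
        moreover have "\<bar>M.moment T (z - w)\<bar> \<le> B * (1/2) ^ N"
        proof -
          have "\<bar>M.moment T (z - w)\<bar> \<le> B * norm (z - w)" by (rule B)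
          also have "\<dots> \<le> B * (1/2) ^ N" using y(3) B(1) by (intro mult_left_mono) (auto simp: w_def dist_norm)
          finally show ?thesis .
        qed
        ultimately show ?thesis by (simp add: linear_diff[OF lin])
      qed
      then have "\<exists>N0. \<forall>N\<ge>N0. \<bar>M.moment T z\<bar> \<le> C * (norm z + 1)\<^sup>2 * (1/2) ^ N + B * (1/2) ^ N" by blast
      moreover have "(\<lambda>N. C * (norm z + 1)\<^sup>2 * (1/2) ^ N + B * (1/2) ^ N) \<longlonglongrightarrow> C * (norm z + 1)\<^sup>2 * 0 + B * 0"
        by (intro tendsto_intros LIMSEQ_realpow_zero) auto
      ultimately have "\<bar>M.moment T z\<bar> \<le> C * (norm z + 1)\<^sup>2 * 0 + B * 0" by (intro LIMSEQ_le_const)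
      then show ?thesis by simp
    qed
    have "K.supp \<subseteq> span L.supp"
    proof
      fix z assume "z \<in> K.supp"
      then have "z \<in> span M.supp" using K(3) by (intro approx_in_span[OF M(2)]) blast
      then show "z \<in> span L.supp" using span_mono[OF Mspan] by (auto simp: span_span)
    qed
    \<comment> \<open>The moment is nonzero at \<open>e\<close>, which lies in the span of the
      minimal support, so its kernel there is a proper subspace.\<close>
    then have "dim K.supp < dim L.supp"
      using e neg null by (intro dim_kernel_less[OF lin, of _ _ e]) auto
    then show ?thesis using minimal[OF K(1,2)] by simp
  qed
qed

subsection \<open>Radon measures\<close>

lemma radon_measureD:
  fixes M :: "'a::euclidean_space measure"
  assumes "radon_measure M"
  shows "sets M = sets borel" "space M = UNIV" "emeasure M (ball x r) < \<infinity>" "emeasure M (cball x r) < \<infinity>"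
proof -
  show s: "sets M = sets borel" using assms by (simp add: radon_measure_def)
  show "space M = UNIV" using sets_eq_imp_space_eq[OF s] by simp
  show c: "emeasure M (cball x r) < \<infinity>" using assms by (simp add: radon_measure_def)
  have "emeasure M (ball x r) \<le> emeasure M (cball x r)" by (intro emeasure_mono) (auto simp: s)
  then show "emeasure M (ball x r) < \<infinity>" using c by (rule le_less_trans)
qed

locale radon =
  fixes M :: "'a::euclidean_space measure"
  assumes radon: "radon_measure M"
begin

lemma sets_M [measurable_cong]: "sets M = sets borel" using radon by (rule radon_measureD)
lemma space_M [simp]: "space M = UNIV" using radon by (rule radon_measureD)
lemma ball_sets [measurable]: "ball x r \<in> sets M" by (simp add: sets_M)
lemma emeasure_ball_finite: "emeasure M (ball x r) < \<infinity>" using radon by (rule radon_measureD)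
lemma emeasure_ball: "emeasure M (ball x r) = ennreal (measure M (ball x r))"
  using emeasure_ball_finite[of x r] by (intro emeasure_eq_ennreal_measure) auto

sublocale sigma_finite_measure M
proof
  show "\<exists>A. countable A \<and> A \<subseteq> sets M \<and> \<Union> A = space M \<and> (\<forall>a\<in>A. emeasure M a \<noteq> \<infinity>)"
  proof (intro exI[of _ "range (\<lambda>n. ball 0 (real n))"] conjI ballI)
    show "\<Union> (range (\<lambda>n. ball 0 (real n))) = space M"
      by (auto simp: reals_Archimedean2)
    show "emeasure M a \<noteq> \<infinity>" if "a \<in> range (\<lambda>n. ball 0 (real n))" for a
      using that emeasure_ball_finite[of 0] by (auto simp: less_top)
  qed (auto simp: sets_M)
qed

text \<open>The ball is a section of a measurable set in the product space, which gives joint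
  measurability in the centre and the radius, as the later uses of Tonelli require.\<close>

lemma emeasure_ball_measurable [measurable]:
  assumes [measurable]: "f \<in> N \<rightarrow>\<^sub>M borel" "g \<in> N \<rightarrow>\<^sub>M borel"
  shows "(\<lambda>w. emeasure M (ball (f w) (g w))) \<in> borel_measurable N"
proof -
  let ?Q = "{p \<in> space (N \<Otimes>\<^sub>M M). dist (f (fst p)) (snd p) < g (fst p)}"
  have "?Q \<in> sets (N \<Otimes>\<^sub>M M)" by measurable
  then have "(\<lambda>w. emeasure M (Pair w -` ?Q)) \<in> borel_measurable N"
    by (rule measurable_emeasure_Pair)
  moreover have "emeasure M (Pair w -` ?Q) = emeasure M (ball (f w) (g w))" if "w \<in> space N" for w
    using that by (intro arg_cong[of _ _ "emeasure M"]) (auto simp: space_pair_measure)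
  ultimately show ?thesis
    using measurable_cong[of N "\<lambda>w. emeasure M (Pair w -` ?Q)" "\<lambda>w. emeasure M (ball (f w) (g w))"] by blast
qed

lemma measure_ball_measurable [measurable]:
  assumes [measurable]: "f \<in> N \<rightarrow>\<^sub>M borel" "g \<in> N \<rightarrow>\<^sub>M borel"
  shows "(\<lambda>w. measure M (ball (f w) (g w))) \<in> borel_measurable N"
  unfolding measure_def by measurable

lemma Delta_measurable [measurable]:
  assumes [measurable]: "f \<in> N \<rightarrow>\<^sub>M borel" "g \<in> N \<rightarrow>\<^sub>M borel"
  shows "(\<lambda>w. Delta s M (f w) (g w)) \<in> borel_measurable N"
  unfolding Delta_def theta_def by measurable

lemma theta_measurable [measurable]:
  assumes [measurable]: "f \<in> N \<rightarrow>\<^sub>M borel" "g \<in> N \<rightarrow>\<^sub>M borel"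
  shows "(\<lambda>w. theta s M (f w) (g w)) \<in> borel_measurable N"
  unfolding theta_def by measurable

lemma measure_ball_mono: "ball x r \<subseteq> ball y t \<Longrightarrow> measure M (ball x r) \<le> measure M (ball y t)"
  using emeasure_mono[of "ball x r" "ball y t" M] by (simp add: sets_M emeasure_ball)

section \<open>Averaging density differences over scales\<close>

lemma Cc_integrable:
  assumes f: "f \<in> Cc"
  shows "integrable M f"
proof -
  obtain R where R: "R > 0" "\<And>x. R < norm x \<Longrightarrow> f x = 0" using Cc_bounded_support[OF f] by blast
  obtain B where B: "B > 0" "\<And>x. \<bar>f x\<bar> \<le> B" using Cc_bounded[OF f] by blast
  have "f \<in> borel_measurable borel" by (intro borel_measurable_continuous_onI Cc_continuous f)
  then have "f \<in> borel_measurable M" by (simp add: measurable_cong_sets[OF sets_M refl])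
  then show ?thesis
    using B R by (intro integrableI_bounded_set[of "cball 0 R" _ _ B])
      (auto simp: sets_M intro: radon_measureD(4)[OF radon, simplified])
qed

text \<open>Layer cake: \<open>- 4 * u * (1 - u\<^sup>2)\<close> is the derivative of the profile \<open>(1 - u\<^sup>2)\<^sup>2\<close>.\<close>

lemma integral_bump:
  assumes T: "T > 0"
  shows "(\<integral>y. bump x T y \<partial>M) = (LBINT u:{0..1}. 4 * u * (1 - u\<^sup>2) * measure M (ball x (u * T)))"
proof -
  have [measurable]: "bump x T \<in> borel_measurable M"
    using Cc_integrable[OF bump_Cc[OF T]] by (rule borel_measurable_integrable)
  have pt: "ennreal (bump x T y) = (\<integral>\<^sup>+u. ennreal (4 * u * (1 - u\<^sup>2)) * indicator {0..1} u * indicator (ball x (u * T)) y \<partial>lborel)" for y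
  proof -
    define v where "v = min 1 (dist x y / T)"
    have v: "0 \<le> v" "v \<le> 1" using T by (auto simp: v_def)
    have "(\<integral>\<^sup>+u. ennreal (4 * u * (1 - u\<^sup>2)) * indicator {0..1} u * indicator (ball x (u * T)) y \<partial>lborel)
      = (\<integral>\<^sup>+u. ennreal (4 * u * (1 - u\<^sup>2)) * indicator {v..1} u \<partial>lborel)"
    proof (intro nn_integral_cong_AE)
      \<comment> \<open>At u = v the open ball just misses \<open>y\<close>; this single value is
        discarded as a null set. At u = 1 the weight itself is zero.\<close>
      have "AE u in lborel. u \<noteq> v" by (rule AE_lborel_singleton)
      then show "AE u in lborel. ennreal (4 * u * (1 - u\<^sup>2)) * indicator {0..1} u * indicator (ball x (u * T)) y =
         ennreal (4 * u * (1 - u\<^sup>2)) * indicator {v..1} u"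
      proof eventually_elim
        case (elim u)
        show ?case
        proof (cases "u \<in> {0..<1}")
          case True
          then have "u * T < T" using T by simp
          have "dist x y < u * T \<longleftrightarrow> v \<le> u"
          proof (cases "dist x y < T")
            case lt: True
            then have "dist x y = v * T" using T by (simp add: v_def)
            then show ?thesis using elim T by auto
          next
            case False
            then have "v = 1" using T by (simp add: v_def)
            then show ?thesis using False True \<open>u * T < T\<close> by auto
          qed
          then show ?thesis using True v by (auto simp: indicator_def)
        next
          case False
          then show ?thesis using v by (cases "u = 1") (auto simp: indicator_def)
        qed
      qed
    qed
    also have "\<dots> = ennreal ((2 * 1\<^sup>2 - 1 ^ 4) - (2 * v\<^sup>2 - v ^ 4))"
    proof (rule nn_integral_FTC_Icc)
      fix u assume u: "u \<in> {v..1}"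
      show "((\<lambda>u. 2 * u\<^sup>2 - u ^ 4) has_real_derivative 4 * u * (1 - u\<^sup>2)) (at u)"
        by (auto intro!: derivative_eq_intros simp: power2_eq_square power3_eq_cube algebra_simps)
      show "0 \<le> 4 * u * (1 - u\<^sup>2)" using u v by (simp add: power_le_one)
    qed (use v in auto)
    also have "(2 * 1\<^sup>2 - 1 ^ 4) - (2 * v\<^sup>2 - v ^ 4) = (1 - v\<^sup>2)\<^sup>2"
      by (simp add: power2_eq_square power4_eq_xxxx algebra_simps)
    also have "1 - v\<^sup>2 = bump1 T (y - x)"
      using T abs_square_le_1[of "norm (y - x) / T"]
      by (auto simp: v_def bump1_def min_def max_def dist_norm norm_minus_commute)
    finally show ?thesis by (simp add: bump_def)
  qed
  have "(\<integral>\<^sup>+y. ennreal (bump x T y) \<partial>M) =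
    (\<integral>\<^sup>+y. (\<integral>\<^sup>+u. ennreal (4 * u * (1 - u\<^sup>2)) * indicator {0..1} u * indicator (ball x (u * T)) y \<partial>lborel) \<partial>M)"
    by (simp only: pt)
  also have "\<dots> = (\<integral>\<^sup>+u. (\<integral>\<^sup>+y. ennreal (4 * u * (1 - u\<^sup>2)) * indicator {0..1} u * indicator (ball x (u * T)) y \<partial>M) \<partial>lborel)"
  proof -
    interpret P: pair_sigma_finite lborel M ..
    have [measurable]: "Measurable.pred (lborel \<Otimes>\<^sub>M M) (\<lambda>p. snd p \<in> ball x (fst p * T))"
      unfolding mem_ball by measurable
    have "(\<lambda>(u, y). ennreal (4 * u * (1 - u\<^sup>2)) * indicator {0..1} u * indicator (ball x (u * T)) y) \<in> borel_measurable (lborel \<Otimes>\<^sub>M M)"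
      unfolding case_prod_beta indicator_def by measurable
    from P.Fubini'[OF this] show ?thesis .
  qed
  also have "\<dots> = (\<integral>\<^sup>+u. ennreal (indicator {0..1} u *\<^sub>R (4 * u * (1 - u\<^sup>2) * measure M (ball x (u * T)))) \<partial>lborel)"
  proof (intro nn_integral_cong)
    fix u :: real
    have "(\<integral>\<^sup>+y. ennreal (4 * u * (1 - u\<^sup>2)) * indicator {0..1} u * indicator (ball x (u * T)) y \<partial>M) =
      ennreal (4 * u * (1 - u\<^sup>2)) * indicator {0..1} u * emeasure M (ball x (u * T))"
      by (subst nn_integral_cmult_indicator) (auto simp: sets_M)
    also have "\<dots> = ennreal (indicator {0..1} u *\<^sub>R (4 * u * (1 - u\<^sup>2) * measure M (ball x (u * T))))"
      unfolding emeasure_ball by (cases "u \<in> {0..1}") (auto simp: ennreal_mult power_le_one)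
    finally show "(\<integral>\<^sup>+y. ennreal (4 * u * (1 - u\<^sup>2)) * indicator {0..1} u * indicator (ball x (u * T)) y \<partial>M) = \<dots>" .
  qed
  finally have eq: "(\<integral>\<^sup>+y. ennreal (bump x T y) \<partial>M) =
    (\<integral>\<^sup>+u. ennreal (indicator {0..1} u *\<^sub>R (4 * u * (1 - u\<^sup>2) * measure M (ball x (u * T)))) \<partial>lborel)" .
  have "(\<integral>y. bump x T y \<partial>M) = enn2real (\<integral>\<^sup>+y. ennreal (bump x T y) \<partial>M)"
    by (intro integral_eq_nn_integral) auto
  also have "\<dots> = (LBINT u:{0..1}. 4 * u * (1 - u\<^sup>2) * measure M (ball x (u * T)))"
    unfolding eq set_lebesgue_integral_def
    by (intro integral_eq_nn_integral[symmetric]) (auto simp: indicator_def power_le_one intro!: AE_I2)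
  finally show ?thesis .
qed

text \<open>By the layer-cake formula this equals the average of u^s
  \<open>Delta s M x (u * T)\<close> over u in [0,1] with weight 4 u (1 - u^2). It involves bumps
  only, so it survives weak limits.\<close>

definition smooth_Delta :: "real \<Rightarrow> 'a \<Rightarrow> real \<Rightarrow> real" where
  "smooth_Delta s x T = (\<integral>y. bump x T y \<partial>M) / T powr s - (\<integral>y. bump x (2 * T) y \<partial>M) / (2 * T) powr s"

text \<open>Cauchy-Schwarz on the unit interval is followed by r = T u, whose Jacobian is the
  \<open>T\<close> on the left. The weight times u^s is at most 4, which gives 16.\<close>

lemma smooth_Delta_bound:
  assumes T: "T > 0" and s: "s > 0"
  shows "ennreal (T * (smooth_Delta s x T)\<^sup>2) \<le>
    16 * (\<integral>\<^sup>+r. ennreal ((Delta s M x r)\<^sup>2) * indicator {0<..<T} r \<partial>lborel)"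
proof -
  define w where "w = (\<lambda>u::real. 4 * u * (1 - u\<^sup>2))"
  have w: "0 \<le> w u" "w u \<le> 4" if "u \<in> {0..1}" for u
  proof -
    have a: "0 \<le> u" "u \<le> 1" "0 \<le> 1 - u\<^sup>2" "1 - u\<^sup>2 \<le> 1" using that by (auto simp: power_le_one)
    show "0 \<le> w u" using a by (simp add: w_def)
    show "w u \<le> 4" unfolding w_def using mult_mono[OF a(2) a(4)] a by simp
  qed
  have w_meas [measurable]: "w \<in> borel_measurable borel" unfolding w_def by measurable
  define g where "g = (\<lambda>u. w u * (measure M (ball x (u * T)) / T powr s - measure M (ball x (u * (2 * T))) / (2 * T) powr s))"
  have g_meas [measurable]: "g \<in> borel_measurable borel" unfolding g_def by measurable
  define m where "m = (\<lambda>t u. w u * measure M (ball x (u * t)))"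
  have m_meas [measurable]: "m t \<in> borel_measurable borel" for t unfolding m_def by measurable
  have m_int: "set_integrable lborel {0..1} (m t)" if "t > 0" for t
    unfolding set_integrable_def
  proof (rule integrableI_bounded_set[of "{0..1}" _ _ "4 * measure M (ball x t)"])
    show "AE u\<in>{0..1} in lborel. norm (indicator {0..1} u *\<^sub>R m t u) \<le> 4 * measure M (ball x t)"
    proof (intro AE_I2 impI)
      fix u :: real assume u: "u \<in> {0..1}"
      then have "measure M (ball x (u * t)) \<le> measure M (ball x t)"
        using that by (intro measure_ball_mono subset_ball) (auto simp: mult_le_cancel_right1)
      then show "norm (indicator {0..1} u *\<^sub>R m t u) \<le> 4 * measure M (ball x t)"
        using w[OF u] u by (auto simp: m_def abs_mult intro!: mult_mono)
    qed
  qed auto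
  have g_eq: "g u = m T u / T powr s - m (2 * T) u / (2 * T) powr s" for u
    by (simp add: g_def m_def right_diff_distrib)
  have g_int: "set_integrable lborel {0..1} g"
    unfolding g_eq using T by (intro set_integral_diff set_integrable_divide m_int) auto
  let ?D = "smooth_Delta s x T"
  have D: "?D = (LBINT u:{0..1}. g u)"
    using T unfolding smooth_Delta_def g_eq
    by (subst set_integral_diff) (auto simp: integral_bump m_def w_def intro!: m_int[unfolded m_def w_def])
  define B where "B = 4 * (measure M (ball x T) / T powr s + measure M (ball x (2 * T)) / (2 * T) powr s)"
  have g_le: "\<bar>g u\<bar> \<le> B" if u: "u \<in> {0..1}" for u
  proof -
    have "measure M (ball x (u * t)) \<le> measure M (ball x t)" if "t > 0" for t
      using that u by (intro measure_ball_mono subset_ball) (auto simp: mult_le_cancel_right1)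
    then have *: "measure M (ball x (u * t)) / t powr s \<le> measure M (ball x t) / t powr s" if "t > 0" for t
      using that by (intro divide_right_mono) auto
    have "\<bar>measure M (ball x (u * T)) / T powr s - measure M (ball x (u * (2 * T))) / (2 * T) powr s\<bar>
      \<le> measure M (ball x T) / T powr s + measure M (ball x (2 * T)) / (2 * T) powr s"
    proof -
      have "\<bar>a - b\<bar> \<le> a' + b'" if "0 \<le> a" "a \<le> a'" "0 \<le> b" "b \<le> b'" for a b a' b' :: real
        using that by linarith
      then show ?thesis using *[of T] *[of "2 * T"] T by simp
    qed
    then show ?thesis using w[OF u] unfolding g_def B_def abs_mult by (intro mult_mono) auto
  qed
  have g2_int: "set_integrable lborel {0..1} (\<lambda>u. (g u)\<^sup>2)"
    unfolding set_integrable_def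
  proof (rule integrableI_bounded_set[of "{0..1}" _ _ "B\<^sup>2"])
    show "AE u\<in>{0..1} in lborel. norm (indicator {0..1} u *\<^sub>R (g u)\<^sup>2) \<le> B\<^sup>2"
      using g_le by (intro AE_I2 impI) (auto intro!: power2_le_iff_abs_le[THEN iffD2] intro: order_trans[OF abs_ge_zero])
  qed auto
  \<comment> \<open>Expanding this nonnegative integral is Cauchy-Schwarz on an interval of length
    1.\<close>
  have "0 \<le> (LBINT u:{0..1}. (g u - ?D)\<^sup>2)"
    unfolding set_lebesgue_integral_def by (intro integral_nonneg_AE) auto
  also have "(LBINT u:{0..1}. (g u - ?D)\<^sup>2) = (LBINT u:{0..1}. ((g u)\<^sup>2 - 2 * ?D * g u) + ?D\<^sup>2)"
    by (simp add: power2_diff algebra_simps)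
  also have "\<dots> = (LBINT u:{0..1}. (g u)\<^sup>2) - 2 * ?D * ?D + ?D\<^sup>2"
  proof -
    have c: "set_integrable lborel {0..1} (\<lambda>u::real. ?D\<^sup>2)" unfolding set_integrable_def by simp
    have l: "set_integrable lborel {0..1} (\<lambda>u. 2 * ?D * g u)" using g_int by (rule set_integrable_mult_right)
    show ?thesis
      unfolding set_integral_add(2)[OF set_integral_diff(1)[OF g2_int l] c] set_integral_diff(2)[OF g2_int l]
      by (simp add: D[symmetric] set_lebesgue_integral_def[of lborel _ "\<lambda>_. ?D\<^sup>2"])
  qed
  finally have "?D\<^sup>2 \<le> (LBINT u:{0..1}. (g u)\<^sup>2)" by (simp add: power2_eq_square)
  then have "ennreal (?D\<^sup>2) \<le> ennreal (LBINT u:{0..1}. (g u)\<^sup>2)" by (rule ennreal_leI)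
  also have "\<dots> = (\<integral>\<^sup>+u. ennreal (indicator {0..1} u *\<^sub>R (g u)\<^sup>2) \<partial>lborel)"
    unfolding set_lebesgue_integral_def using g2_int
    by (intro nn_integral_eq_integral[symmetric]) (auto simp: set_integrable_def)
  also have "\<dots> \<le> (\<integral>\<^sup>+u. 16 * (ennreal ((Delta s M x (0 + T * u))\<^sup>2) * indicator {0<..<T} (0 + T * u)) \<partial>lborel)"
  proof (intro nn_integral_mono_AE)
    have "AE u in lborel. u \<noteq> (0::real)" "AE u in lborel. u \<noteq> (1::real)" by (rule AE_lborel_singleton)+
    then show "AE u in lborel. ennreal (indicator {0..1} u *\<^sub>R (g u)\<^sup>2)
      \<le> 16 * (ennreal ((Delta s M x (0 + T * u))\<^sup>2) * indicator {0<..<T} (0 + T * u))"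
    proof eventually_elim
      case (elim u)
      show ?case
      proof (cases "u \<in> {0..1}")
        case True
        then have u: "0 < u" "u < 1" using elim by auto
        have g': "g u = w u * u powr s * Delta s M x (T * u)"
          using T u by (simp add: g_def Delta_def theta_def powr_mult field_simps)
        have "\<bar>w u * u powr s\<bar> \<le> 4 * 1"
          unfolding abs_mult using w[OF True] u s by (intro mult_mono) (auto intro: powr_le1)
        then have "(w u * u powr s)\<^sup>2 \<le> 4\<^sup>2" by (intro power2_le_iff_abs_le[THEN iffD2]) auto
        then have "(g u)\<^sup>2 \<le> 4\<^sup>2 * (Delta s M x (T * u))\<^sup>2"
          unfolding g' power_mult_distrib[of _ "Delta s M x (T * u)"] by (intro mult_right_mono) auto
        then have "ennreal ((g u)\<^sup>2) \<le> ennreal (16 * (Delta s M x (T * u))\<^sup>2)" by (intro ennreal_leI) simp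
        also have "\<dots> = 16 * ennreal ((Delta s M x (T * u))\<^sup>2)" by (subst ennreal_mult) auto
        finally show ?thesis using True T u by simp
      qed simp
    qed
  qed
  also have "\<dots> = 16 * (\<integral>\<^sup>+u. ennreal ((Delta s M x (0 + T * u))\<^sup>2) * indicator {0<..<T} (0 + T * u) \<partial>lborel)"
    by (intro nn_integral_cmult) measurable
  finally have *: "ennreal (?D\<^sup>2) \<le> 16 * (\<integral>\<^sup>+u. ennreal ((Delta s M x (0 + T * u))\<^sup>2) * indicator {0<..<T} (0 + T * u) \<partial>lborel)" .
  have "ennreal (T * ?D\<^sup>2) = ennreal T * ennreal (?D\<^sup>2)" using T by (simp add: ennreal_mult)
  also have "\<dots> \<le> ennreal T * (16 * (\<integral>\<^sup>+u. ennreal ((Delta s M x (0 + T * u))\<^sup>2) * indicator {0<..<T} (0 + T * u) \<partial>lborel))"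
    using * by (rule mult_left_mono) simp
  also have "\<dots> = 16 * (ennreal \<bar>T\<bar> * (\<integral>\<^sup>+u. ennreal ((Delta s M x (0 + T * u))\<^sup>2) * indicator {0<..<T} (0 + T * u) \<partial>lborel))"
    using T by (simp add: mult_ac)
  also have "\<dots> = 16 * (\<integral>\<^sup>+r. ennreal ((Delta s M x r)\<^sup>2) * indicator {0<..<T} r \<partial>lborel)"
    using T by (subst nn_integral_real_affine[of "\<lambda>r. ennreal ((Delta s M x r)\<^sup>2) * indicator {0<..<T} r" T 0]) auto
  finally show ?thesis .
qed

end

subsection \<open>The compactness argument\<close>

context radon begin

text \<open>The ball \<open>ball x R\<close> becomes the unit ball with mass 1, so limits do not see
  the size of the measure or the scale. If that ball is null, division by zero yields the zero
  functional, which is still positive.\<close>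

definition rescaled :: "'a \<Rightarrow> real \<Rightarrow> ('a \<Rightarrow> real) \<Rightarrow> real" where
  "rescaled x R f = (\<integral>y. f ((1 / R) *\<^sub>R (y - x)) \<partial>M) / measure M (ball x R)"

lemma pos_functional_rescaled:
  assumes R: "R > 0"
  shows "pos_functional (rescaled x R)"
proof
  have int: "integrable M (\<lambda>y. f ((1 / R) *\<^sub>R (y - x)))" if "f \<in> Cc" for f
    using that R by (intro Cc_integrable Cc_affine) auto
  show "rescaled x R (\<lambda>y. f y + g y) = rescaled x R f + rescaled x R g" if "f \<in> Cc" "g \<in> Cc" for f g
    using that by (simp add: rescaled_def int add_divide_distrib)
  show "rescaled x R (\<lambda>y. c * f y) = c * rescaled x R f" for f c
    by (simp add: rescaled_def)
  show "0 \<le> rescaled x R f" if "\<And>y. 0 \<le> f y" for f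
    unfolding rescaled_def using that by (intro divide_nonneg_nonneg integral_nonneg_AE) auto
qed

lemma rescaled_bump:
  assumes R: "R > 0"
  shows "rescaled x R (bump w t) = (\<integral>y. bump (x + R *\<^sub>R w) (t * R) y \<partial>M) / measure M (ball x R)"
proof -
  have "bump w t ((1 / R) *\<^sub>R (y - x)) = bump (x + R *\<^sub>R w) (t * R) y" for y
    using R bump_affine[of "1 / R" w t y x] by simp
  then show ?thesis by (simp add: rescaled_def)
qed

lemma integral_bump_le:
  assumes t: "t > 0" and sub: "ball z t \<subseteq> ball x r"
  shows "(\<integral>y. bump z t y \<partial>M) \<le> measure M (ball x r)"
proof -
  have "(\<integral>y. bump z t y \<partial>M) \<le> (\<integral>y. indicator (ball x r) y \<partial>M)"
  proof (rule integral_mono)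
    show "integrable M (bump z t)" by (intro Cc_integrable bump_Cc t)
    show "integrable M (indicator (ball x r) :: 'a \<Rightarrow> real)"
      using emeasure_ball_finite[of x r] by (simp add: sets_M)
    show "bump z t y \<le> indicator (ball x r) y" for y
    proof (cases "dist z y < t")
      case True
      then have "y \<in> ball x r" using sub by auto
      then show ?thesis using bump_le_one by simp
    next
      case False
      then show ?thesis using t bump_eq_0[of t z y] by simp
    qed
  qed
  then show ?thesis by (simp add: sets_M)
qed

text \<open>The radius is integrated against dr rather than dr/r; the weight 1/r is recovered when
  the estimates are integrated over \<open>R\<close>.\<close>

definition local_energy :: "real \<Rightarrow> 'a \<Rightarrow> real \<Rightarrow> ennreal" where
  "local_energy s x R = (\<integral>\<^sup>+y. (\<integral>\<^sup>+r. ennreal ((Delta s M y r)\<^sup>2) * indicator {0<..<R} r \<partial>lborel) * indicator (ball x R) y \<partial>M)"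

text \<open>A Chebyshev bound: a smoothed difference bounded away from 0 on a small ball forces
  energy in proportion to the mass of that ball.\<close>

lemma smooth_Delta_lower_bound:
  assumes T: "T > 0" and s: "s > 0" and TR: "T \<le> R" and sub: "ball z \<rho> \<subseteq> ball x R"
    and lower: "\<And>y. y \<in> ball z \<rho> \<Longrightarrow> \<kappa> \<le> (smooth_Delta s y T)\<^sup>2"
  shows "ennreal (T * \<kappa> * measure M (ball z \<rho>)) \<le> 16 * local_energy s x R"
proof (cases "\<kappa> \<le> 0")
  case True
  then have "T * \<kappa> * measure M (ball z \<rho>) \<le> 0" using T by (simp add: mult_nonneg_nonpos mult_nonpos_nonneg)
  then show ?thesis by (simp add: ennreal_neg)
next
  case False
  have "ennreal (T * \<kappa> * measure M (ball z \<rho>)) = ennreal (T * \<kappa>) * emeasure M (ball z \<rho>)"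
    using T False by (simp add: emeasure_ball ennreal_mult)
  also have "\<dots> = (\<integral>\<^sup>+y. ennreal (T * \<kappa>) * indicator (ball z \<rho>) y \<partial>M)"
    by (simp add: nn_integral_cmult_indicator sets_M)
  also have "\<dots> \<le> (\<integral>\<^sup>+y. 16 * ((\<integral>\<^sup>+r. ennreal ((Delta s M y r)\<^sup>2) * indicator {0<..<R} r \<partial>lborel) * indicator (ball x R) y) \<partial>M)"
  proof (intro nn_integral_mono)
    fix y
    show "ennreal (T * \<kappa>) * indicator (ball z \<rho>) y \<le>
      16 * ((\<integral>\<^sup>+r. ennreal ((Delta s M y r)\<^sup>2) * indicator {0<..<R} r \<partial>lborel) * indicator (ball x R) y)"
    proof (cases "y \<in> ball z \<rho>")
      case True
      have "ennreal (T * \<kappa>) \<le> ennreal (T * (smooth_Delta s y T)\<^sup>2)"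
        using lower[OF True] T by (intro ennreal_leI mult_left_mono) auto
      also have "\<dots> \<le> 16 * (\<integral>\<^sup>+r. ennreal ((Delta s M y r)\<^sup>2) * indicator {0<..<T} r \<partial>lborel)"
        by (rule smooth_Delta_bound[OF T s])
      also have "\<dots> \<le> 16 * (\<integral>\<^sup>+r. ennreal ((Delta s M y r)\<^sup>2) * indicator {0<..<R} r \<partial>lborel)"
        using TR by (intro mult_left_mono nn_integral_mono) (auto simp: indicator_def)
      finally show ?thesis using True sub by (simp add: subset_eq)
    qed simp
  qed
  also have "\<dots> = 16 * local_energy s x R"
    unfolding local_energy_def by (intro nn_integral_cmult) measurable
  finally show ?thesis .
qed

end

text \<open>A single natural number serves as multiplicative constant and as dilation factor, so
  negating the claim at \<open>Suc n\<close> yields counterexamples with relatively shrinking energy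
  on growing balls. The measure is quantified inside, which makes the constant universal.\<close>

lemma doubling_local_energy:
  fixes s :: real
  assumes s: "s > 0" "s \<notin> \<int>"
  shows "\<exists>A::nat. A > 0 \<and> (\<forall>(M :: 'a::euclidean_space measure) x R. radon_measure M \<longrightarrow> R > 0 \<longrightarrow>
    (\<forall>j. theta s M x (2 ^ j * R) \<le> 2 ^ j * theta s M x R) \<longrightarrow>
    ennreal ((theta s M x R)\<^sup>2 * measure M (ball x R) * R) \<le> of_nat A * radon.local_energy M s x (real A * R))"
proof (rule ccontr)
  assume neg: "\<not> ?thesis"
  have "\<exists>(M :: 'a measure) x R. radon_measure M \<and> R > 0 \<and>
      (\<forall>j. theta s M x (2 ^ j * R) \<le> 2 ^ j * theta s M x R) \<and>
      of_nat (Suc n) * radon.local_energy M s x (real (Suc n) * R) < ennreal ((theta s M x R)\<^sup>2 * measure M (ball x R) * R)" for n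
  proof -
    from neg have "\<not> (\<forall>(M :: 'a measure) x R. radon_measure M \<longrightarrow> R > 0 \<longrightarrow>
      (\<forall>j. theta s M x (2 ^ j * R) \<le> 2 ^ j * theta s M x R) \<longrightarrow>
      ennreal ((theta s M x R)\<^sup>2 * measure M (ball x R) * R) \<le> of_nat (Suc n) * radon.local_energy M s x (real (Suc n) * R))"
      by blast
    then show ?thesis unfolding not_le[symmetric] by blast
  qed
  then obtain M :: "nat \<Rightarrow> 'a measure" and x R where M: "\<And>n. radon_measure (M n)" and R: "\<And>n. R n > 0"
    and dbl: "\<And>n j. theta s (M n) (x n) (2 ^ j * R n) \<le> 2 ^ j * theta s (M n) (x n) (R n)"
    and small: "\<And>n. of_nat (Suc n) * radon.local_energy (M n) s (x n) (real (Suc n) * R n)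
      < ennreal ((theta s (M n) (x n) (R n))\<^sup>2 * measure (M n) (ball (x n) (R n)) * R n)"
    by metis
  have rad: "radon (M n)" for n using M by unfold_locales
  define m where "m = (\<lambda>n. measure (M n) (ball (x n) (R n)))"
  have th: "theta s (M n) (x n) (R n) = m n / R n powr s" for n by (simp add: theta_def m_def)
  \<comment> \<open>The strict inequality in \<open>small\<close> excludes null balls, so the
    normalisation is legitimate.\<close>
  have m: "m n > 0" for n
  proof (rule ccontr)
    assume "\<not> m n > 0"
    then have "m n = 0" by (simp add: m_def zero_less_measure_iff)
    then show False using small[of n] by (simp add: th m_def)
  qed
  define \<Lambda> where "\<Lambda> = (\<lambda>n. radon.rescaled (M n) (x n) (R n))"
  have pos: "pos_functional (\<Lambda> n)" for n
    unfolding \<Lambda>_def by (rule radon.pos_functional_rescaled[OF rad R])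
  have \<Lambda>bump: "\<Lambda> n (bump w t) = (\<integral>y. bump (x n + R n *\<^sub>R w) (t * R n) y \<partial>M n) / m n" for n w t
    unfolding \<Lambda>_def m_def by (rule radon.rescaled_bump[OF rad R])
  \<comment> \<open>The growth hypothesis enters here: it bounds the normalised mass of each fixed
    ball uniformly in n.\<close>
  have "\<exists>C. \<forall>n. \<Lambda> n (bump 0 t) \<le> C" if t: "t > 0" for t
  proof -
    obtain j where j: "t < 2 ^ j" using real_arch_pow[of 2 t] by auto
    have "\<Lambda> n (bump 0 t) \<le> 2 ^ j * (2 ^ j) powr s" for n
    proof -
      have "(\<integral>y. bump (x n) (t * R n) y \<partial>M n) \<le> measure (M n) (ball (x n) (2 ^ j * R n))"
        using t R[of n] j by (intro radon.integral_bump_le[OF rad] subset_ball) auto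
      also have "\<dots> = theta s (M n) (x n) (2 ^ j * R n) * (2 ^ j * R n) powr s"
        using R[of n] by (simp add: theta_def)
      also have "\<dots> \<le> 2 ^ j * theta s (M n) (x n) (R n) * (2 ^ j * R n) powr s"
        using dbl by (intro mult_right_mono) auto
      also have "\<dots> = 2 ^ j * (2 ^ j) powr s * m n" using R[of n] by (simp add: th powr_mult)
      finally show ?thesis using m[of n] by (simp add: \<Lambda>bump pos_divide_le_eq)
    qed
    then show ?thesis by blast
  qed
  from pos_functional_cluster[of \<Lambda>, OF pos this]
  obtain F L where F: "F \<noteq> bot" "F \<le> sequentially" "pos_functional L"
    "\<And>f. f \<in> Cc \<Longrightarrow> ((\<lambda>n. \<Lambda> n f) \<longlongrightarrow> L f) F" by blast
  interpret L: pos_functional L by (rule F)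

  \<comment> \<open>Mass does not escape in the limit: the unit ball keeps normalised mass 1, and
    the bump of radius 2 sees at least half of it.\<close>
  have "1/2 \<le> \<Lambda> n (bump 0 2)" for n
  proof -
    interpret radon "M n" by (rule rad)
    have "m n / 2 = (\<integral>y. (1/2) * indicator (ball (x n) (R n)) y \<partial>M n)" by (simp add: m_def sets_M)
    also have "\<dots> \<le> (\<integral>y. bump (x n) (2 * R n) y \<partial>M n)"
    proof (rule integral_mono)
      show "integrable (M n) (bump (x n) (2 * R n))" using R[of n] by (intro Cc_integrable bump_Cc) auto
      show "integrable (M n) (\<lambda>y. (1/2) * indicator (ball (x n) (R n)) y :: real)"
        using emeasure_ball_finite[of "x n" "R n"] by (simp add: sets_M)
      show "(1/2) * indicator (ball (x n) (R n)) y \<le> bump (x n) (2 * R n) y" for y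
        using bump_ge_half[of "2 * R n" "x n" y] R[of n] by (auto simp: indicator_def)
    qed
    finally show ?thesis using m[of n] by (simp add: \<Lambda>bump field_simps)
  qed
  then have "1/2 \<le> L (bump 0 2)"
    by (intro tendsto_lowerbound[OF F(4) _ F(1)] bump_Cc always_eventually allI) auto
  then have nonempty: "L.supp \<noteq> {}" using L.null_supp[of "bump 0 2"] bump_Cc[of 2 "0::'a"] by auto

  have per: "L (bump z (2 * t)) = 2 powr s * L (bump z t)" if z: "z \<in> L.supp" and t: "t > 0" for z t
  proof (rule ccontr)
    assume ne: "L (bump z (2 * t)) \<noteq> 2 powr s * L (bump z t)"
    define d where "d = (\<lambda>n w. \<Lambda> n (bump w t) - 2 powr - s * \<Lambda> n (bump w (2 * t)))"
    \<comment> \<open>|d n z| tends to 3\<epsilon>, hence eventually exceeds 2\<epsilon>; the two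
      Lipschitz errors of \<epsilon>/2 leave \<epsilon> on the whole \<rho>-ball.\<close>
    define \<epsilon> where "\<epsilon> = \<bar>L (bump z t) - 2 powr - s * L (bump z (2 * t))\<bar> / 3"
    have \<epsilon>: "\<epsilon> > 0" using ne by (auto simp: \<epsilon>_def powr_minus field_simps)
    define C where "C = max (L (bump z (4 * t))) (L (bump z (8 * t))) + 1"
    have C: "C > 0" using L.bump_nonneg[of "4 * t" z] t by (simp add: C_def add_nonneg_pos)
    \<comment> \<open>The 16 makes the Lipschitz error 8 (\<rho>/t) C at most \<epsilon>/2.\<close>
    define \<rho> where "\<rho> = min t (\<epsilon> * t / (16 * C))"
    have \<rho>: "\<rho> > 0" "\<rho> \<le> t" using t \<epsilon> C by (auto simp: \<rho>_def)
    have \<rho>C: "16 * \<rho> / t * C \<le> \<epsilon>"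
    proof -
      have "\<rho> \<le> \<epsilon> * t / (16 * C)" by (simp add: \<rho>_def)
      then show ?thesis using t C by (simp add: field_simps)
    qed
    have "((\<lambda>n. \<bar>d n z\<bar>) \<longlongrightarrow> 3 * \<epsilon>) F"
      unfolding d_def \<epsilon>_def using t by (auto intro!: tendsto_intros F bump_Cc)
    then have e1: "eventually (\<lambda>n. 2 * \<epsilon> < \<bar>d n z\<bar>) F" using \<epsilon> by (intro order_tendstoD(1)[of _ "3 * \<epsilon>"]) auto
    have e2: "eventually (\<lambda>n. \<Lambda> n (bump z (4 * t)) < C) F" "eventually (\<lambda>n. \<Lambda> n (bump z (8 * t)) < C) F"
      using t by (auto intro!: order_tendstoD(2)[OF F(4)] bump_Cc simp: C_def)
    have e3: "eventually (\<lambda>n. N \<le> n) F" for N by (rule filter_leD[OF F(2) eventually_ge_at_top])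
    obtain N :: nat where N: "norm z + t \<le> real N" using real_arch_simple by blast
    \<comment> \<open>\<open>K\<close> is solved from the final balance, in which
      \<open>?T * \<kappa> * (K * m n)\<close> must equal 16 times the squared density times
      \<open>m n * R n\<close>; it does not depend on n.\<close>
    define K where "K = 16 * t powr (2 * s - 1) / \<epsilon>\<^sup>2"
    \<comment> \<open>A difference of size \<epsilon> near \<open>z\<close> costs energy
      proportional to the mass there, but the available energy carries a factor 1 / (n + 1); so the
      mass near \<open>z\<close> tends to 0, against \<open>z\<close> being in the support.\<close>
    have "eventually (\<lambda>n. \<Lambda> n (bump z \<rho>) \<le> K / real (Suc n)) F"
      using e1 e2 e3[of N]
    proof eventually_elim
      case (elim n)
      interpret radon "M n" by (rule rad)
      interpret P: pos_functional "\<Lambda> n" by (rule pos)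
      let ?T = "t * R n" and ?z = "x n + R n *\<^sub>R z"
      have T: "?T > 0" using t R[of n] by simp
      have dw: "\<epsilon> \<le> \<bar>d n w\<bar>" if w: "dist z w < \<rho>" for w
      proof -
        have a: "\<bar>\<Lambda> n (bump z t) - \<Lambda> n (bump w t)\<bar> \<le> \<epsilon> / 2"
        proof -
          have "\<bar>\<Lambda> n (bump z t) - \<Lambda> n (bump w t)\<bar> \<le> 8 * dist z w / t * \<Lambda> n (bump z (4 * t))"
            using w \<rho> t by (intro P.bump_lipschitz) auto
          also have "\<dots> \<le> 8 * \<rho> / t * C"
            using w t elim(2) P.bump_nonneg[of "4 * t" z] \<rho>(1) by (intro mult_mono divide_right_mono) auto
          finally show ?thesis using \<rho>C by simp
        qed
        have b: "\<bar>\<Lambda> n (bump z (2 * t)) - \<Lambda> n (bump w (2 * t))\<bar> \<le> \<epsilon> / 2"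
        proof -
          have "\<bar>\<Lambda> n (bump z (2 * t)) - \<Lambda> n (bump w (2 * t))\<bar> \<le> 8 * dist z w / (2 * t) * \<Lambda> n (bump z (4 * (2 * t)))"
            using w \<rho> t by (intro P.bump_lipschitz) auto
          also have "\<dots> \<le> 8 * \<rho> / t * C"
            using w t elim(3) P.bump_nonneg[of "8 * t" z] \<rho>(1) by (intro mult_mono frac_le) auto
          finally show ?thesis using \<rho>C by simp
        qed
        have "2 powr - s * \<bar>\<Lambda> n (bump z (2 * t)) - \<Lambda> n (bump w (2 * t))\<bar> \<le> 1 * (\<epsilon> / 2)"
          using b s(1) powr_mono[of "- s" 0 "2::real"] by (intro mult_mono) auto
        then have "\<bar>2 powr - s * \<Lambda> n (bump z (2 * t)) - 2 powr - s * \<Lambda> n (bump w (2 * t))\<bar> \<le> \<epsilon> / 2"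
          by (simp add: right_diff_distrib[symmetric] abs_mult)
        with a elim(1) show ?thesis unfolding d_def by linarith
      qed
      define \<kappa> where "\<kappa> = (\<epsilon> * m n / ?T powr s)\<^sup>2"
      have low: "\<kappa> \<le> (smooth_Delta s y ?T)\<^sup>2" if y: "y \<in> ball ?z (\<rho> * R n)" for y
      proof -
        define w where "w = (1 / R n) *\<^sub>R (y - x n)"
        have yw: "y = x n + R n *\<^sub>R w" using R[of n] by (simp add: w_def)
        have "dist ?z y = R n * dist z w" using R[of n] by (simp add: yw dist_norm flip: scaleR_diff_right)
        then have "dist z w < \<rho>" using y R[of n] by (simp add: mult.commute)
        then have *: "\<epsilon> \<le> \<bar>d n w\<bar>" by (rule dw)
        have "smooth_Delta s y ?T = m n / ?T powr s * d n w"
          using m[of n] t R[of n] unfolding smooth_Delta_def d_def \<Lambda>bump yw[symmetric]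
          by (simp add: powr_mult powr_minus field_simps)
        then have "\<bar>smooth_Delta s y ?T\<bar> = m n / ?T powr s * \<bar>d n w\<bar>" using m[of n] by (simp add: abs_mult)
        then have "\<epsilon> * m n / ?T powr s \<le> \<bar>smooth_Delta s y ?T\<bar>"
          using * m[of n] mult_left_mono[OF *, of "m n / ?T powr s"] by (simp add: mult.commute)
        then have "(\<epsilon> * m n / ?T powr s)\<^sup>2 \<le> \<bar>smooth_Delta s y ?T\<bar>\<^sup>2"
          using \<epsilon> m[of n] by (intro power_mono) auto
        then show ?thesis by (simp add: \<kappa>_def)
      qed
      have nN: "norm z + t \<le> real (Suc n)" using N elim(4) by linarith
      have "ennreal (?T * \<kappa> * measure (M n) (ball ?z (\<rho> * R n))) \<le> 16 * local_energy s (x n) (real (Suc n) * R n)"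
      proof (rule smooth_Delta_lower_bound[OF T s(1) _ _ low])
        have "t \<le> real (Suc n)" using nN norm_ge_zero[of z] by linarith
        then show "?T \<le> real (Suc n) * R n" using R[of n] by (intro mult_right_mono) auto
        show "ball ?z (\<rho> * R n) \<subseteq> ball (x n) (real (Suc n) * R n)"
        proof
          fix y assume "y \<in> ball ?z (\<rho> * R n)"
          then have "dist (x n) y < R n * norm z + \<rho> * R n"
            using dist_triangle[of "x n" y ?z] R[of n] by (simp add: dist_norm)
          also have "\<dots> \<le> (norm z + t) * R n" using \<rho>(2) R[of n] by (simp add: algebra_simps)
          also have "\<dots> \<le> real (Suc n) * R n" using nN R[of n] by (intro mult_right_mono) auto
          finally show "y \<in> ball (x n) (real (Suc n) * R n)" by simp
        qed
      qed
      then have "of_nat (Suc n) * ennreal (?T * \<kappa> * measure (M n) (ball ?z (\<rho> * R n)))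
        \<le> of_nat (Suc n) * (16 * local_energy s (x n) (real (Suc n) * R n))" by (rule mult_left_mono) simp
      also have "\<dots> = 16 * (of_nat (Suc n) * local_energy s (x n) (real (Suc n) * R n))" by (simp only: mult_ac)
      also have "\<dots> \<le> 16 * ennreal ((theta s (M n) (x n) (R n))\<^sup>2 * m n * R n)"
        using less_imp_le[OF small[of n]] unfolding m_def by (rule mult_left_mono) simp
      finally have "ennreal (real (Suc n) * (?T * \<kappa> * measure (M n) (ball ?z (\<rho> * R n))))
        \<le> ennreal (16 * ((theta s (M n) (x n) (R n))\<^sup>2 * m n * R n))"
        using T m[of n] R[of n] by (simp add: ennreal_mult \<kappa>_def ennreal_of_nat_eq_real_of_nat del: of_nat_Suc)
      then have "real (Suc n) * (?T * \<kappa> * measure (M n) (ball ?z (\<rho> * R n))) \<le> 16 * ((theta s (M n) (x n) (R n))\<^sup>2 * m n * R n)"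
        using m[of n] R[of n] by (subst (asm) ennreal_le_iff) auto
      also have "16 * ((theta s (M n) (x n) (R n))\<^sup>2 * m n * R n) = ?T * \<kappa> * (K * m n)"
      proof -
        have "?T * \<kappa> * (K * m n) = 16 * (m n)\<^sup>2 * m n * R n * (t powr (2 * s - 1) * t) / (?T powr s)\<^sup>2"
          using \<epsilon> by (simp add: \<kappa>_def K_def power_divide power_mult_distrib field_simps)
        also have "t powr (2 * s - 1) * t = (t powr s)\<^sup>2"
          using t powr_mult_base[of t "2 * s - 1"] by (simp add: mult.commute power2_eq_square powr_add[symmetric])
        also have "16 * (m n)\<^sup>2 * m n * R n * (t powr s)\<^sup>2 / (?T powr s)\<^sup>2 = 16 * ((theta s (M n) (x n) (R n))\<^sup>2 * m n * R n)"
          using t R[of n] by (simp add: th powr_mult power_divide power_mult_distrib)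
        finally show ?thesis ..
      qed
      finally have "(?T * \<kappa>) * (real (Suc n) * measure (M n) (ball ?z (\<rho> * R n))) \<le> (?T * \<kappa>) * (K * m n)"
        by (simp only: mult_ac)
      moreover have "?T * \<kappa> > 0" using T \<epsilon> m[of n] t R[of n] by (simp add: \<kappa>_def)
      ultimately have "real (Suc n) * measure (M n) (ball ?z (\<rho> * R n)) \<le> K * m n"
        by (subst (asm) mult_le_cancel_left_pos)
      moreover have "(\<integral>y. bump ?z (\<rho> * R n) y \<partial>M n) \<le> measure (M n) (ball ?z (\<rho> * R n))"
        using \<rho>(1) R[of n] by (intro integral_bump_le) auto
      then have "\<Lambda> n (bump z \<rho>) * m n \<le> measure (M n) (ball ?z (\<rho> * R n))" using m[of n] by (simp add: \<Lambda>bump)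
      then have "real (Suc n) * (\<Lambda> n (bump z \<rho>) * m n) \<le> real (Suc n) * measure (M n) (ball ?z (\<rho> * R n))"
        by (intro mult_left_mono) auto
      ultimately have "(\<Lambda> n (bump z \<rho>) * real (Suc n)) * m n \<le> K * m n" by (simp only: mult_ac)
      then have "\<Lambda> n (bump z \<rho>) * real (Suc n) \<le> K" using m[of n] by (subst (asm) mult_le_cancel_right_pos)
      then show ?case by (simp add: pos_le_divide_eq del: of_nat_Suc)
    qed
    moreover have "((\<lambda>n. K / real (Suc n)) \<longlongrightarrow> 0) F"
      by (rule tendsto_mono[OF F(2)]) (rule LIMSEQ_Suc[OF lim_const_over_n])
    ultimately have "L (bump z \<rho>) \<le> 0" using \<rho>(1) by (intro tendsto_le[OF F(1) _ F(4)] bump_Cc) 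
    moreover have "0 < L (bump z \<rho>)" using z \<rho>(1) by (simp add: L.supp_def)
    ultimately show False by simp
  qed
  obtain x0 where x0: "x0 \<in> L.supp" using nonempty by blast
  have "uniform_functional L s (\<lambda>t. L (bump x0 t))"
  proof unfold_locales
    show "L (bump y t) = L (bump x0 t)" if "y \<in> L.supp" "t > 0" for y t
      using per that x0 by (intro L.bump_independent)
    show "0 < L (bump x0 t)" if "t > 0" for t using x0 that by (simp add: L.supp_def)
    show "L (bump x0 (2 * t)) = 2 powr s * L (bump x0 t)" if "t > 0" for t using per x0 that by blast
  qed
  then have "s \<in> \<int>" using nonempty by (rule uniform_functional.exponent_integer)
  with s(2) show False by contradiction
qed

subsection \<open>Summing the local estimates\<close>

lemma ennreal_inverse_antimono: "a \<le> b \<Longrightarrow> inverse b \<le> inverse (a :: ennreal)"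
  unfolding less_eq_ennreal.rep_eq inverse_ennreal.rep_eq by (intro ereal_inverse_antimono) simp_all

lemma finite_half_balls:
  fixes A :: real
  obtains D :: "'a::euclidean_space set" where "finite D" "cball 0 A \<subseteq> (\<Union>a\<in>D. ball a (1/2))"
  using compactE_image[OF compact_cball[of "0::'a" A], of "cball 0 A" "\<lambda>a. ball a (1/2)"]
  by (metis UN_I centre_in_ball half_gt_zero_iff open_ball subsetI zero_less_one)

lemma nn_integral_scale_invariant:
  fixes f :: "real \<Rightarrow> real"
  assumes [measurable]: "f \<in> borel_measurable borel" and c: "c > 0"
  shows "(\<integral>\<^sup>+r\<in>{0<..}. ennreal (f (c * r) / r) \<partial>lborel) = (\<integral>\<^sup>+r\<in>{0<..}. ennreal (f r / r) \<partial>lborel)"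
proof -
  have "(\<integral>\<^sup>+r\<in>{0<..}. ennreal (f r / r) \<partial>lborel) =
    ennreal \<bar>c\<bar> * (\<integral>\<^sup>+r. ennreal (f (0 + c * r) / (0 + c * r)) * indicator {0<..} (0 + c * r) \<partial>lborel)"
    using c by (intro nn_integral_real_affine) auto
  also have "\<dots> = (\<integral>\<^sup>+r. ennreal c * (ennreal (f (0 + c * r) / (0 + c * r)) * indicator {0<..} (0 + c * r)) \<partial>lborel)"
    using c by (subst nn_integral_cmult) auto
  also have "\<dots> = (\<integral>\<^sup>+r\<in>{0<..}. ennreal (f (c * r) / r) \<partial>lborel)"
  proof (intro nn_integral_cong)
    fix r :: real
    show "ennreal c * (ennreal (f (0 + c * r) / (0 + c * r)) * indicator {0<..} (0 + c * r)) =
      ennreal (f (c * r) / r) * indicator {0<..} r"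
    proof (cases "r > 0")
      case True
      have "ennreal c * ennreal (f (c * r) / (c * r)) = ennreal (c * (f (c * r) / (c * r)))"
        using c by (subst ennreal_mult'[symmetric]) auto
      then show ?thesis using True c by simp
    next
      case False
      then show ?thesis using c by (simp add: zero_less_mult_iff)
    qed
  qed
  finally show ?thesis by simp
qed

context radon begin

abbreviation square_function :: "real \<Rightarrow> 'a \<Rightarrow> ennreal" where
  "square_function s x \<equiv> (\<integral>\<^sup>+r\<in>{0<..}. ennreal ((Delta s M x r)\<^sup>2 / r) \<partial>lborel)"

abbreviation density_energy :: "real \<Rightarrow> 'a \<Rightarrow> ennreal" where
  "density_energy s x \<equiv> (\<integral>\<^sup>+r\<in>{0<..}. ennreal ((theta s M x r)\<^sup>2 / r) \<partial>lborel)"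

lemma theta_nonneg: "0 \<le> theta s M x r"
  by (simp add: theta_def)

text \<open>With these parameters \<alpha> p = d - s and 1 / (p - 1) = 2.\<close>

lemma wolff_eq:
  "wolff (2/3 * (real DIM('a) - s)) (3/2) M x = density_energy s x"
proof -
  have "real DIM('a) - 2/3 * (real DIM('a) - s) * (3/2) = s" "1 / (3/2 - 1) = (2::real)"
    by (simp_all add: field_simps)
  then show ?thesis
    unfolding wolff_def theta_def by (intro nn_integral_cong) (simp add: powr_numeral del: divide_eq_eq)
qed

text \<open>After (a - b)^2 \<le> 2 a^2 + 2 b^2, invariance of dr/r under r \<mapsto> 2r makes both
  terms give the same integral, so 4 = 2 + 2.\<close>

lemma square_function_le: "square_function s x \<le> 4 * density_energy s x"
proof -
  have [measurable]: "(\<lambda>r. theta s M x r) \<in> borel_measurable borel"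
    by (rule theta_measurable) auto
  have "square_function s x \<le> (\<integral>\<^sup>+r. 2 * (ennreal ((theta s M x r)\<^sup>2 / r) * indicator {0<..} r)
    + 2 * (ennreal ((theta s M x (2 * r))\<^sup>2 / r) * indicator {0<..} r) \<partial>lborel)"
  proof (intro nn_integral_mono)
    fix r :: real
    show "ennreal ((Delta s M x r)\<^sup>2 / r) * indicator {0<..} r \<le>
      2 * (ennreal ((theta s M x r)\<^sup>2 / r) * indicator {0<..} r)
      + 2 * (ennreal ((theta s M x (2 * r))\<^sup>2 / r) * indicator {0<..} r)"
    proof (cases "r > 0")
      case True
      have "(Delta s M x r)\<^sup>2 \<le> 2 * (theta s M x r)\<^sup>2 + 2 * (theta s M x (2 * r))\<^sup>2"
        unfolding Delta_def using zero_le_power2[of "theta s M x r + theta s M x (2 * r)"]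
        by (simp add: power2_eq_square algebra_simps)
      then have "(Delta s M x r)\<^sup>2 / r \<le> (2 * (theta s M x r)\<^sup>2 + 2 * (theta s M x (2 * r))\<^sup>2) / r"
        using True by (intro divide_right_mono) auto
      then have "ennreal ((Delta s M x r)\<^sup>2 / r) \<le> ennreal (2 * ((theta s M x r)\<^sup>2 / r) + 2 * ((theta s M x (2 * r))\<^sup>2 / r))"
        by (intro ennreal_leI) (simp add: add_divide_distrib)
      also have "\<dots> = 2 * ennreal ((theta s M x r)\<^sup>2 / r) + 2 * ennreal ((theta s M x (2 * r))\<^sup>2 / r)"
      proof -
        have "ennreal (2 * a + 2 * b) = 2 * ennreal a + 2 * ennreal b" if "0 \<le> a" "0 \<le> b" for a b
          using that by (simp add: ennreal_mult)
        then show ?thesis using True by (simp only: divide_nonneg_pos zero_le_power2)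
      qed
      finally show ?thesis using True by simp
    qed simp
  qed
  also have "\<dots> = 2 * density_energy s x + 2 * (\<integral>\<^sup>+r\<in>{0<..}. ennreal ((theta s M x (2 * r))\<^sup>2 / r) \<partial>lborel)"
    by (subst nn_integral_add) (auto simp: nn_integral_cmult)
  also have "(\<integral>\<^sup>+r\<in>{0<..}. ennreal ((theta s M x (2 * r))\<^sup>2 / r) \<partial>lborel) = density_energy s x"
    by (rule nn_integral_scale_invariant[of "\<lambda>r. (theta s M x r)\<^sup>2" 2]) auto
  also have "2 * density_energy s x + 2 * density_energy s x = (2 + 2) * density_energy s x"
    by (simp only: distrib_right)
  finally show ?thesis by simp
qed

text \<open>If all differences above scale \<open>R\<close> are small relative to \<open>theta s M x R\<close>, telescoping
  yields the growth condition of \<open>doubling_local_energy\<close>.\<close>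

lemma theta_dichotomy:
  assumes "\<not> theta s M x (2 ^ j * R) \<le> 2 ^ j * theta s M x R"
  shows "\<exists>i. (theta s M x R)\<^sup>2 \<le> (1/4) ^ i * (Delta s M x (2 ^ i * R))\<^sup>2"
proof (rule ccontr)
  assume "\<not> ?thesis"
  then have *: "\<And>i. (1/4) ^ i * (Delta s M x (2 ^ i * R))\<^sup>2 < (theta s M x R)\<^sup>2" by (simp add: not_le)
  \<comment> \<open>These bounds are what the induction needs, since 2^i + 2^i = 2^(i+1).\<close>
  have D: "\<bar>Delta s M x (2 ^ i * R)\<bar> \<le> 2 ^ i * theta s M x R" for i
  proof -
    have "(1/4) ^ i * (Delta s M x (2 ^ i * R))\<^sup>2 = (Delta s M x (2 ^ i * R) / 2 ^ i)\<^sup>2"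
      by (simp add: power_divide power_one_over power_mult[symmetric] mult.commute[of i] power_mult)
    with *[of i] have "(Delta s M x (2 ^ i * R) / 2 ^ i)\<^sup>2 \<le> (theta s M x R)\<^sup>2" by simp
    then have "\<bar>Delta s M x (2 ^ i * R) / 2 ^ i\<bar> \<le> theta s M x R"
      using power2_le_iff_abs_le[OF theta_nonneg] by blast
    then show ?thesis by (simp add: abs_divide pos_divide_le_eq mult.commute)
  qed
  have "theta s M x (2 ^ i * R) \<le> 2 ^ i * theta s M x R" for i
  proof (induction i)
    case (Suc i)
    have "theta s M x (2 * (2 ^ i * R)) = theta s M x (2 ^ i * R) - Delta s M x (2 ^ i * R)"
      by (simp add: Delta_def)
    then show ?case using Suc D[of i] by (simp add: mult.assoc)
  qed simp
  with assms show False by blast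
qed

text \<open>Cover by half-radius balls \<open>B a\<close>. Such a ball containing \<open>x\<close>
  lies in \<open>ball x R\<close>, so the reciprocal mass of \<open>ball x R\<close> is at most that
  of \<open>B a\<close>, and each resulting quotient integrates to at most 1. The bound is thus
  independent of the measure.\<close>

lemma reciprocal_ball_bound:
  fixes D :: "'a set"
  assumes D: "finite D" "cball 0 A \<subseteq> (\<Union>a\<in>D. ball a (1/2))" and R: "R > 0"
  shows "(\<integral>\<^sup>+x. indicator (ball y (A * R)) x / emeasure M (ball x R) \<partial>M) \<le> of_nat (card D)"
proof -
  define B where "B = (\<lambda>a. ball (y + R *\<^sub>R a) (R / 2))"
  have "(\<integral>\<^sup>+x. indicator (ball y (A * R)) x / emeasure M (ball x R) \<partial>M) \<le>
    (\<integral>\<^sup>+x. (\<Sum>a\<in>D. indicator (B a) x / emeasure M (B a)) \<partial>M)"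
  proof (intro nn_integral_mono)
    fix x
    show "indicator (ball y (A * R)) x / emeasure M (ball x R) \<le> (\<Sum>a\<in>D. indicator (B a) x / emeasure M (B a))"
    proof (cases "x \<in> ball y (A * R)")
      case True
      define w where "w = (1 / R) *\<^sub>R (x - y)"
      have xw: "x = y + R *\<^sub>R w" using R by (simp add: w_def)
      have "norm w \<le> A" using True R by (simp add: xw dist_norm mult.commute)
      then obtain a where a: "a \<in> D" "dist a w < 1/2" using D(2) by force
      have "dist (y + R *\<^sub>R a) x = R * dist a w" using R by (simp add: xw dist_norm flip: scaleR_diff_right)
      then have d: "dist (y + R *\<^sub>R a) x < R / 2" using a(2) R by simp
      then have xB: "x \<in> B a" by (simp add: B_def)
      have "B a \<subseteq> ball x R"
      proof
        fix z assume "z \<in> B a"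
        then have "dist (y + R *\<^sub>R a) z < R / 2" by (simp add: B_def)
        then show "z \<in> ball x R" using d dist_triangle3[of x z "y + R *\<^sub>R a"] by simp
      qed
      then have "emeasure M (B a) \<le> emeasure M (ball x R)" by (intro emeasure_mono ball_sets)
      then have "indicator (ball y (A * R)) x / emeasure M (ball x R) \<le> indicator (B a) x / emeasure M (B a)"
        using True xB by (simp add: divide_ennreal_def ennreal_inverse_antimono)
      also have "\<dots> \<le> (\<Sum>a\<in>D. indicator (B a) x / emeasure M (B a))"
        using a(1) D(1) by (intro member_le_sum) auto
      finally show ?thesis .
    qed simp
  qed
  also have "\<dots> = (\<Sum>a\<in>D. (\<integral>\<^sup>+x. indicator (B a) x / emeasure M (B a) \<partial>M))"
    by (intro nn_integral_sum) (simp add: B_def)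
  also have "\<dots> \<le> (\<Sum>a\<in>D. 1)"
  proof (intro sum_mono)
    fix a
    have "(\<integral>\<^sup>+x. indicator (B a) x / emeasure M (B a) \<partial>M) = emeasure M (B a) / emeasure M (B a)"
      by (subst nn_integral_divide) (auto simp: B_def)
    \<comment> \<open>A null ball contributes 0, because 0 / 0 = 0 here.\<close>
    also have "\<dots> \<le> 1"
      using emeasure_ball_finite[of "y + R *\<^sub>R a" "R / 2"]
      by (cases "emeasure M (B a) = 0") (auto simp: ennreal_divide_self B_def)
    finally show "(\<integral>\<^sup>+x. indicator (B a) x / emeasure M (B a) \<partial>M) \<le> 1" .
  qed
  finally show ?thesis by simp
qed

text \<open>The constraint r < A R leaves R > r / A, and integrating R^-2 there produces the weight
  1 / r of the square function.\<close>

lemma inverse_square_tail: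
  assumes "r > 0" "A > 0"
  shows "(\<integral>\<^sup>+R. ennreal (1 / R\<^sup>2) * indicator {0<..} R * indicator {0<..<A * R} r \<partial>lborel) \<le> ennreal (A / r)"
proof -
  have "(\<integral>\<^sup>+R. ennreal (1 / R\<^sup>2) * indicator {0<..} R * indicator {0<..<A * R} r \<partial>lborel)
    \<le> (\<integral>\<^sup>+R. ennreal (1 / R\<^sup>2) * indicator {r / A..} R \<partial>lborel)"
    using assms by (intro nn_integral_mono) (auto simp: indicator_def field_simps)
  also have "\<dots> = ennreal (0 - (- 1 / (r / A)))"
  proof (rule nn_integral_FTC_atLeast)
    fix x assume "r / A \<le> x"
    then have x: "x > 0" using assms by (meson divide_pos_pos less_le_trans)
    then show "((\<lambda>x. - 1 / x) has_real_derivative 1 / x\<^sup>2) (at x)"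
      by (auto intro!: derivative_eq_intros simp: power2_eq_square)
    show "0 \<le> 1 / x\<^sup>2" by simp
  next
    show "((\<lambda>x::real. - 1 / x) \<longlongrightarrow> 0) at_top"
      by (intro tendsto_divide_0[OF tendsto_const] filterlim_at_top_imp_at_infinity filterlim_ident)
  qed auto
  finally show ?thesis using assms by simp
qed

text \<open>General \<open>f\<close> and \<open>g\<close> cover at once the joint measurability and
  both kinds of slices, in which one of the two points is frozen.\<close>

lemma cutoff_measurable:
  assumes f: "f \<in> N \<rightarrow>\<^sub>M M \<Otimes>\<^sub>M lborel" and g: "g \<in> N \<rightarrow>\<^sub>M M \<Otimes>\<^sub>M lborel"
  shows "(\<lambda>w. indicator {0<..<A * snd (f w)} (snd (g w)) * indicator (ball (fst (f w)) (A * snd (f w))) (fst (g w)) :: ennreal)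
    \<in> borel_measurable N"
proof -
  have [measurable]: "(\<lambda>w. fst (f w)) \<in> N \<rightarrow>\<^sub>M borel" "(\<lambda>w. fst (g w)) \<in> N \<rightarrow>\<^sub>M borel"
    using measurable_compose[OF f measurable_fst] measurable_compose[OF g measurable_fst]
    by (simp_all add: measurable_cong_sets[OF refl sets_M])
  have [measurable]: "(\<lambda>w. snd (f w)) \<in> N \<rightarrow>\<^sub>M borel" "(\<lambda>w. snd (g w)) \<in> N \<rightarrow>\<^sub>M borel"
    using measurable_compose[OF f measurable_snd] measurable_compose[OF g measurable_snd] by simp_all
  have [measurable]: "Measurable.pred N (\<lambda>w. fst (g w) \<in> ball (fst (f w)) (A * snd (f w)))"
    "Measurable.pred N (\<lambda>w. snd (g w) \<in> {0<..<A * snd (f w)})"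
    unfolding mem_ball greaterThanLessThan_iff by measurable
  show ?thesis unfolding indicator_def by measurable
qed

text \<open>The weight is the one that turns theta^2 m R into theta^2 / R, where m is the mass of
  \<open>ball x R\<close>. After Tonelli the x-integral is a covering count and the R-integral
  supplies A / r.\<close>

lemma local_energy_total:
  fixes D :: "'a set"
  assumes A: "A > 0" and D: "finite D" "cball 0 A \<subseteq> (\<Union>a\<in>D. ball a (1/2))"
  shows "(\<integral>\<^sup>+x. (\<integral>\<^sup>+R. ennreal (1 / R\<^sup>2) * indicator {0<..} R / emeasure M (ball x R) * local_energy s x (A * R) \<partial>lborel) \<partial>M)
    \<le> ennreal A * of_nat (card D) * (\<integral>\<^sup>+y. square_function s y \<partial>M)"
proof -
  interpret P: pair_sigma_finite M lborel ..
  interpret PP: pair_sigma_finite "M \<Otimes>\<^sub>M lborel" "M \<Otimes>\<^sub>M lborel" ..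
  define k where "k = (\<lambda>p::'a \<times> real. ennreal (1 / (snd p)\<^sup>2) * indicator {0<..} (snd p) / emeasure M (ball (fst p) (snd p)))"
  define F where "F = (\<lambda>q::'a \<times> real. ennreal ((Delta s M (fst q) (snd q))\<^sup>2))"
  define I where "I = (\<lambda>(p::'a \<times> real) (q::'a \<times> real). indicator {0<..<A * snd p} (snd q) * indicator (ball (fst p) (A * snd p)) (fst q) :: ennreal)"
  have [measurable]: "k \<in> borel_measurable (M \<Otimes>\<^sub>M lborel)" unfolding k_def by measurable
  have [measurable]: "F \<in> borel_measurable (M \<Otimes>\<^sub>M lborel)" unfolding F_def by measurable
  have "(\<integral>\<^sup>+x. (\<integral>\<^sup>+R. ennreal (1 / R\<^sup>2) * indicator {0<..} R / emeasure M (ball x R) * local_energy s x (A * R) \<partial>lborel) \<partial>M)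
    = (\<integral>\<^sup>+x. (\<integral>\<^sup>+R. (\<integral>\<^sup>+q. k (x, R) * (F q * I (x, R) q) \<partial>(M \<Otimes>\<^sub>M lborel)) \<partial>lborel) \<partial>M)"
  proof (intro nn_integral_cong)
    fix x R
    have [measurable]: "I (x, R) \<in> borel_measurable (M \<Otimes>\<^sub>M lborel)"
      unfolding I_def
      by (rule cutoff_measurable[of "\<lambda>_. (x, R)" "M \<Otimes>\<^sub>M lborel" "\<lambda>q. q" A]) simp_all
    have "local_energy s x (A * R) = (\<integral>\<^sup>+y. (\<integral>\<^sup>+r. F (y, r) * I (x, R) (y, r) \<partial>lborel) \<partial>M)"
      unfolding local_energy_def
    proof (intro nn_integral_cong)
      fix y
      have "(\<integral>\<^sup>+r. F (y, r) * I (x, R) (y, r) \<partial>lborel) =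
        (\<integral>\<^sup>+r. ennreal ((Delta s M y r)\<^sup>2) * indicator {0<..<A * R} r * indicator (ball x (A * R)) y \<partial>lborel)"
        by (simp add: F_def I_def mult.assoc)
      also have "\<dots> = (\<integral>\<^sup>+r. ennreal ((Delta s M y r)\<^sup>2) * indicator {0<..<A * R} r \<partial>lborel) * indicator (ball x (A * R)) y"
        by (rule nn_integral_multc) measurable
      finally show "(\<integral>\<^sup>+r. ennreal ((Delta s M y r)\<^sup>2) * indicator {0<..<A * R} r \<partial>lborel) * indicator (ball x (A * R)) y = (\<integral>\<^sup>+r. F (y, r) * I (x, R) (y, r) \<partial>lborel)" ..
    qed
    also have "\<dots> = (\<integral>\<^sup>+q. F q * I (x, R) q \<partial>(M \<Otimes>\<^sub>M lborel))"
      by (rule lborel.nn_integral_fst[where f = "\<lambda>q. F q * I (x, R) q"]) measurable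
    finally have "k (x, R) * local_energy s x (A * R) = k (x, R) * (\<integral>\<^sup>+q. F q * I (x, R) q \<partial>(M \<Otimes>\<^sub>M lborel))"
      by simp
    also have "\<dots> = (\<integral>\<^sup>+q. k (x, R) * (F q * I (x, R) q) \<partial>(M \<Otimes>\<^sub>M lborel))"
      by (rule nn_integral_cmult[symmetric]) measurable
    finally show "ennreal (1 / R\<^sup>2) * indicator {0<..} R / emeasure M (ball x R) * local_energy s x (A * R) =
      (\<integral>\<^sup>+q. k (x, R) * (F q * I (x, R) q) \<partial>(M \<Otimes>\<^sub>M lborel))"
      by (simp only: k_def fst_conv snd_conv)
  qed
  also have "\<dots> = (\<integral>\<^sup>+p. (\<integral>\<^sup>+q. k p * (F q * I p q) \<partial>(M \<Otimes>\<^sub>M lborel)) \<partial>(M \<Otimes>\<^sub>M lborel))"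
  proof (rule lborel.nn_integral_fst[where f = "\<lambda>p. (\<integral>\<^sup>+q. k p * (F q * I p q) \<partial>(M \<Otimes>\<^sub>M lborel))"])
    have [measurable]: "(\<lambda>w. I (fst w) (snd w)) \<in> borel_measurable ((M \<Otimes>\<^sub>M lborel) \<Otimes>\<^sub>M (M \<Otimes>\<^sub>M lborel))"
      unfolding I_def by (rule cutoff_measurable) auto
    show "(\<lambda>p. (\<integral>\<^sup>+q. k p * (F q * I p q) \<partial>(M \<Otimes>\<^sub>M lborel))) \<in> borel_measurable (M \<Otimes>\<^sub>M lborel)"
      by (rule sigma_finite_measure.borel_measurable_nn_integral, unfold_locales) (simp add: case_prod_beta)
  qed
  also have "\<dots> = (\<integral>\<^sup>+q. (\<integral>\<^sup>+p. k p * (F q * I p q) \<partial>(M \<Otimes>\<^sub>M lborel)) \<partial>(M \<Otimes>\<^sub>M lborel))"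
  proof -
    have [measurable]: "(\<lambda>w. I (fst w) (snd w)) \<in> borel_measurable ((M \<Otimes>\<^sub>M lborel) \<Otimes>\<^sub>M (M \<Otimes>\<^sub>M lborel))"
      unfolding I_def by (rule cutoff_measurable) auto
    show ?thesis
      by (rule PP.Fubini'[symmetric]) (simp add: case_prod_beta)
  qed
  also have "\<dots> \<le> (\<integral>\<^sup>+q. ennreal A * of_nat (card D) * (ennreal ((Delta s M (fst q) (snd q))\<^sup>2 / snd q) * indicator {0<..} (snd q)) \<partial>(M \<Otimes>\<^sub>M lborel))"
  proof (intro nn_integral_mono)
    fix q :: "'a \<times> real"
    obtain y r where q: "q = (y, r)" by (cases q)
    have [measurable]: "(\<lambda>p. I p q) \<in> borel_measurable (M \<Otimes>\<^sub>M lborel)"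
      unfolding I_def by (rule cutoff_measurable) (auto simp: space_pair_measure intro!: measurable_const)
    \<comment> \<open>The cutoff is symmetric in x and y, so for fixed (y, r) it localises x to a
      ball about y.\<close>
    have Isym: "I (x, R) q = indicator {0<..<A * R} r * indicator (ball y (A * R)) x" for x R
      by (simp add: I_def q indicator_def dist_commute)
    show "(\<integral>\<^sup>+p. k p * (F q * I p q) \<partial>(M \<Otimes>\<^sub>M lborel)) \<le>
      ennreal A * of_nat (card D) * (ennreal ((Delta s M (fst q) (snd q))\<^sup>2 / snd q) * indicator {0<..} (snd q))"
    proof (cases "r > 0")
      case False
      then have "I p q = 0" for p by (simp add: I_def q)
      then show ?thesis by simp
    next
      case r: True
      have "(\<integral>\<^sup>+p. k p * (F q * I p q) \<partial>(M \<Otimes>\<^sub>M lborel)) = F q * (\<integral>\<^sup>+p. k p * I p q \<partial>(M \<Otimes>\<^sub>M lborel))"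
        by (subst nn_integral_cmult[symmetric]) (auto simp: mult_ac)
      also have "(\<integral>\<^sup>+p. k p * I p q \<partial>(M \<Otimes>\<^sub>M lborel)) = (\<integral>\<^sup>+R. (\<integral>\<^sup>+x. k (x, R) * I (x, R) q \<partial>M) \<partial>lborel)"
        by (rule P.nn_integral_snd[symmetric, where f = "\<lambda>p. k p * I p q"]) measurable
      also have "\<dots> \<le> (\<integral>\<^sup>+R. of_nat (card D) * (ennreal (1 / R\<^sup>2) * indicator {0<..} R * indicator {0<..<A * R} r) \<partial>lborel)"
      proof (intro nn_integral_mono)
        fix R :: real
        show "(\<integral>\<^sup>+x. k (x, R) * I (x, R) q \<partial>M) \<le> of_nat (card D) * (ennreal (1 / R\<^sup>2) * indicator {0<..} R * indicator {0<..<A * R} r)"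
        proof (cases "R > 0")
          case False
          then show ?thesis by (simp add: k_def)
        next
          case True
          have "(\<integral>\<^sup>+x. k (x, R) * I (x, R) q \<partial>M) =
            (\<integral>\<^sup>+x. (ennreal (1 / R\<^sup>2) * indicator {0<..} R * indicator {0<..<A * R} r) * (indicator (ball y (A * R)) x / emeasure M (ball x R)) \<partial>M)"
            by (intro nn_integral_cong) (simp add: k_def Isym divide_ennreal_def mult_ac)
          also have "\<dots> = (ennreal (1 / R\<^sup>2) * indicator {0<..} R * indicator {0<..<A * R} r) * (\<integral>\<^sup>+x. indicator (ball y (A * R)) x / emeasure M (ball x R) \<partial>M)"
            by (rule nn_integral_cmult) measurable
          also have "\<dots> \<le> (ennreal (1 / R\<^sup>2) * indicator {0<..} R * indicator {0<..<A * R} r) * of_nat (card D)"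
            by (intro mult_left_mono reciprocal_ball_bound D True) auto
          finally show ?thesis by (simp only: mult.commute)
        qed
      qed
      also have "\<dots> = of_nat (card D) * (\<integral>\<^sup>+R. ennreal (1 / R\<^sup>2) * indicator {0<..} R * indicator {0<..<A * R} r \<partial>lborel)"
      proof (rule nn_integral_cmult)
        have [measurable]: "Measurable.pred borel (\<lambda>R. r \<in> {0<..<A * R})"
          unfolding greaterThanLessThan_iff by measurable
        show "(\<lambda>R. ennreal (1 / R\<^sup>2) * indicator {0<..} R * indicator {0<..<A * R} r) \<in> borel_measurable lborel"
          unfolding indicator_def by measurable
      qed
      also have "\<dots> \<le> of_nat (card D) * ennreal (A / r)"
        by (intro mult_left_mono inverse_square_tail r A) auto
      finally have "(\<integral>\<^sup>+p. k p * (F q * I p q) \<partial>(M \<Otimes>\<^sub>M lborel)) \<le> F q * (of_nat (card D) * ennreal (A / r))"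
        by (simp add: mult_left_mono)
      also have "F q * (of_nat (card D) * ennreal (A / r)) = of_nat (card D) * ennreal ((Delta s M y r)\<^sup>2 * (A / r))"
      proof -
        have "ennreal (A / r) * ennreal ((Delta s M y r)\<^sup>2) = ennreal ((Delta s M y r)\<^sup>2 * (A / r))"
          using r A by (subst ennreal_mult[symmetric]) (auto simp: mult_ac)
        then show ?thesis by (simp add: F_def q mult_ac)
      qed
      also have "(Delta s M y r)\<^sup>2 * (A / r) = A * ((Delta s M y r)\<^sup>2 / r)" by simp
      also have "of_nat (card D) * ennreal (A * ((Delta s M y r)\<^sup>2 / r)) = ennreal A * of_nat (card D) * ennreal ((Delta s M y r)\<^sup>2 / r)"
        using r A by (subst ennreal_mult) (auto simp: mult_ac)
      finally show ?thesis using r by (simp add: q)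
    qed
  qed
  also have "\<dots> = ennreal A * of_nat (card D) * (\<integral>\<^sup>+q. ennreal ((Delta s M (fst q) (snd q))\<^sup>2 / snd q) * indicator {0<..} (snd q) \<partial>(M \<Otimes>\<^sub>M lborel))"
    by (rule nn_integral_cmult) measurable
  also have "(\<integral>\<^sup>+q. ennreal ((Delta s M (fst q) (snd q))\<^sup>2 / snd q) * indicator {0<..} (snd q) \<partial>(M \<Otimes>\<^sub>M lborel)) = (\<integral>\<^sup>+y. square_function s y \<partial>M)"
    by (subst lborel.nn_integral_fst[symmetric]) auto
  finally show ?thesis .
qed

text \<open>The index in the dichotomy varies with x and R; bounding by the whole weighted series
  removes the choice. Its terms have the same integral up to the factor 4^-j, by invariance of dr/r,
  and the geometric sum 4/3 is rounded up to 2.\<close>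

lemma density_energy_le:
  fixes D :: "'a set"
  assumes A: "A > 0" and D: "finite D" "cball 0 A \<subseteq> (\<Union>a\<in>D. ball a (1/2))" and C: "C \<ge> 0"
    and loc: "\<And>x R. R > 0 \<Longrightarrow> (\<forall>j. theta s M x (2 ^ j * R) \<le> 2 ^ j * theta s M x R) \<Longrightarrow>
      ennreal ((theta s M x R)\<^sup>2 * measure M (ball x R) * R) \<le> ennreal C * local_energy s x (A * R)"
  shows "(\<integral>\<^sup>+x. density_energy s x \<partial>M) \<le> ennreal (2 + C * A * real (card D)) * (\<integral>\<^sup>+x. square_function s x \<partial>M)"
proof -
  define G where "G = (\<lambda>x R. ennreal (1 / R\<^sup>2) * indicator {0<..} R / emeasure M (ball x R) * local_energy s x (A * R))"
  define S where "S = (\<lambda>j x R. ennreal ((1/4) ^ j) * (ennreal ((Delta s M x (2 ^ j * R))\<^sup>2 / R) * indicator {0<..} R))"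
  have S_meas [measurable]: "(\<lambda>R. S j x R) \<in> borel_measurable lborel" for j x
    unfolding S_def by measurable
  have pt: "ennreal ((theta s M x R)\<^sup>2 / R) * indicator {0<..} R \<le> (\<Sum>j. S j x R) + ennreal C * G x R" for x R
  proof (cases "R > 0")
    case R: True
    show ?thesis
    proof (cases "\<forall>j. theta s M x (2 ^ j * R) \<le> 2 ^ j * theta s M x R")
      case True
      have "ennreal ((theta s M x R)\<^sup>2 / R) \<le> ennreal C * G x R"
      proof (cases "measure M (ball x R) = 0")
        case True
        then show ?thesis by (simp add: theta_def)
      next
        case False
        define m where "m = measure M (ball x R)"
        have m: "m > 0" using False by (simp add: m_def zero_less_measure_iff)
        have "ennreal ((theta s M x R)\<^sup>2 / R) = ennreal ((theta s M x R)\<^sup>2 * m * R) * ennreal (1 / R\<^sup>2 / m)"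
          using m R by (subst ennreal_mult[symmetric]) (auto simp: power2_eq_square field_simps)
        also have "\<dots> \<le> ennreal C * local_energy s x (A * R) * ennreal (1 / R\<^sup>2 / m)"
          using loc[OF R True] unfolding m_def by (rule mult_right_mono) simp
        also have "\<dots> = ennreal C * G x R"
          using m R unfolding G_def emeasure_ball m_def[symmetric] by (simp add: divide_ennreal mult_ac)
        finally show ?thesis .
      qed
      then show ?thesis using R by (simp add: add_increasing)
    next
      case False
      then obtain i where "(theta s M x R)\<^sup>2 \<le> (1/4) ^ i * (Delta s M x (2 ^ i * R))\<^sup>2"
        using theta_dichotomy by blast
      then have "(theta s M x R)\<^sup>2 / R \<le> (1/4) ^ i * (Delta s M x (2 ^ i * R))\<^sup>2 / R"
        using R by (intro divide_right_mono) auto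
      then have "ennreal ((theta s M x R)\<^sup>2 / R) \<le> ennreal ((1/4) ^ i * ((Delta s M x (2 ^ i * R))\<^sup>2 / R))"
        by (intro ennreal_leI) simp
      also have "\<dots> = S i x R" using R unfolding S_def by (subst ennreal_mult') auto
      also have "\<dots> \<le> (\<Sum>j. S j x R)" using sum_le_suminf[of "\<lambda>j. S j x R" "{i}"] by simp
      finally show ?thesis using R by (simp add: add_increasing2)
    qed
  qed simp
  have local_energy_meas: "(\<lambda>p. local_energy s (fst p) (A * snd p)) \<in> borel_measurable (M \<Otimes>\<^sub>M lborel)"
  proof -
    \<comment> \<open>Cutoffs depending on the parameters are written as \<open>of_bool\<close> of
      predicates, so that joint measurability can be derived.\<close>
    have *: "local_energy s x R = (\<integral>\<^sup>+y. (\<integral>\<^sup>+r. ennreal ((Delta s M y r)\<^sup>2) * of_bool (0 < r \<and> r < R) \<partial>lborel) * of_bool (dist x y < R) \<partial>M)" for x R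
      by (simp add: local_energy_def indicator_def)
    show ?thesis unfolding * by measurable
  qed
  have G_meas [measurable]: "(\<lambda>p. G (fst p) (snd p)) \<in> borel_measurable (M \<Otimes>\<^sub>M lborel)"
    unfolding G_def using local_energy_meas by measurable
  have Gx [measurable]: "(\<lambda>R. G x R) \<in> borel_measurable lborel" for x
    using measurable_compose[OF _ G_meas, of "\<lambda>R. (x, R)" lborel] by simp
  have "density_energy s x \<le> 2 * square_function s x + ennreal C * (\<integral>\<^sup>+R. G x R \<partial>lborel)" for x
  proof -
    have Sint: "(\<integral>\<^sup>+R. S j x R \<partial>lborel) = ennreal ((1/4) ^ j) * square_function s x" for j
    proof -
      have [measurable]: "(\<lambda>r. Delta s M x r) \<in> borel_measurable borel"
        by (rule Delta_measurable) auto
      have "(\<integral>\<^sup>+R. S j x R \<partial>lborel) = ennreal ((1/4) ^ j) * (\<integral>\<^sup>+R\<in>{0<..}. ennreal ((Delta s M x (2 ^ j * R))\<^sup>2 / R) \<partial>lborel)"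
        unfolding S_def by (rule nn_integral_cmult) measurable
      then show ?thesis
        using nn_integral_scale_invariant[of "\<lambda>r. (Delta s M x r)\<^sup>2" "2 ^ j"] by simp
    qed
    have "density_energy s x \<le> (\<integral>\<^sup>+R. (\<Sum>j. S j x R) + ennreal C * G x R \<partial>lborel)"
      by (intro nn_integral_mono pt)
    also have "\<dots> = (\<Sum>j. (\<integral>\<^sup>+R. S j x R \<partial>lborel)) + ennreal C * (\<integral>\<^sup>+R. G x R \<partial>lborel)"
      by (simp add: nn_integral_add nn_integral_suminf nn_integral_cmult)
    also have "(\<Sum>j. (\<integral>\<^sup>+R. S j x R \<partial>lborel)) = (\<Sum>j. ennreal ((1/4) ^ j) * square_function s x)"
      by (simp only: Sint)
    also have "(\<Sum>j. ennreal ((1/4) ^ j) * square_function s x) = (\<Sum>j. ennreal ((1/4) ^ j)) * square_function s x"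
      by (rule ennreal_suminf_multc)
    also have "(\<Sum>j. ennreal ((1/4) ^ j)) = ennreal (4/3)"
      using geometric_sums[of "1/4::real"] by (intro suminf_ennreal_eq) auto
    also have "ennreal (4/3) * square_function s x + ennreal C * (\<integral>\<^sup>+R. G x R \<partial>lborel)
      \<le> 2 * square_function s x + ennreal C * (\<integral>\<^sup>+R. G x R \<partial>lborel)"
      by (intro add_right_mono mult_right_mono) (auto simp: ennreal_le_iff2 simp flip: ennreal_numeral)
    finally show ?thesis .
  qed
  then have "(\<integral>\<^sup>+x. density_energy s x \<partial>M) \<le> (\<integral>\<^sup>+x. 2 * square_function s x + ennreal C * (\<integral>\<^sup>+R. G x R \<partial>lborel) \<partial>M)"
    by (intro nn_integral_mono)
  also have "\<dots> = 2 * (\<integral>\<^sup>+x. square_function s x \<partial>M) + ennreal C * (\<integral>\<^sup>+x. (\<integral>\<^sup>+R. G x R \<partial>lborel) \<partial>M)"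
  proof -
    have [measurable]: "(\<lambda>x. \<integral>\<^sup>+R. G x R \<partial>lborel) \<in> borel_measurable M"
      using G_meas by (intro lborel.borel_measurable_nn_integral) (simp add: case_prod_beta)
    have [measurable]: "(\<lambda>x. square_function s x) \<in> borel_measurable M" by measurable
    show ?thesis by (subst nn_integral_add) (auto simp: nn_integral_cmult)
  qed
  also have "\<dots> \<le> 2 * (\<integral>\<^sup>+x. square_function s x \<partial>M) +
    ennreal C * (ennreal A * of_nat (card D) * (\<integral>\<^sup>+x. square_function s x \<partial>M))"
    unfolding G_def by (intro add_left_mono mult_left_mono local_energy_total A D) auto
  also have "\<dots> = (2 + ennreal C * (ennreal A * of_nat (card D))) * (\<integral>\<^sup>+x. square_function s x \<partial>M)"
    by (simp only: distrib_right mult.assoc)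
  also have "2 + ennreal C * (ennreal A * of_nat (card D)) = ennreal (2 + C * A * real (card D))"
    using A C by (simp add: ennreal_mult ennreal_plus mult.assoc ennreal_of_nat_eq_real_of_nat del: ennreal_plus[symmetric])
  finally show ?thesis .
qed

end

theorem theorem1p1:
  fixes s :: real
  assumes "0 < s" and "s < real DIM('a::euclidean_space)" and "s \<notin> \<int>"
  shows "\<exists>c>0. \<forall>M :: 'a measure. radon_measure M \<longrightarrow>
    (let L = (\<integral>\<^sup>+ x. (\<integral>\<^sup>+ r \<in> {0<..}. ennreal ((Delta s M x r)\<^sup>2 / r) \<partial>lborel) \<partial>M);
         R = (\<integral>\<^sup>+ x. wolff (2/3 * (real DIM('a) - s)) (3/2) M x \<partial>M)
     in L \<le> ennreal c * R \<and> R \<le> ennreal c * L)"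
proof -
  obtain A :: nat where A: "A > 0" and loc: "\<And>(M :: 'a measure) x R. radon_measure M \<Longrightarrow> R > 0 \<Longrightarrow>
    (\<forall>j. theta s M x (2 ^ j * R) \<le> 2 ^ j * theta s M x R) \<Longrightarrow>
    ennreal ((theta s M x R)\<^sup>2 * measure M (ball x R) * R) \<le> of_nat A * radon.local_energy M s x (real A * R)"
    using doubling_local_energy[OF assms(1,3), where 'a = 'a] by blast
  obtain D :: "'a set" where D: "finite D" "cball 0 (real A) \<subseteq> (\<Union>a\<in>D. ball a (1/2))"
    by (rule finite_half_balls)
  \<comment> \<open>The 4 serves the easy inequality and exceeds the 2 of the other;
    \<open>A\<close> appears twice, once as constant and once as dilation. Both \<open>A\<close> and
    \<open>D\<close> are fixed before the measure.\<close>
  define c where "c = 4 + real A * real A * real (card D)"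
  show ?thesis
  proof (intro exI[of _ c] conjI allI impI)
    show "c > 0" by (simp add: c_def add_pos_nonneg)
    fix M :: "'a measure" assume "radon_measure M"
    then interpret radon M by unfold_locales
    let ?L = "\<integral>\<^sup>+x. square_function s x \<partial>M" and ?R = "\<integral>\<^sup>+x. density_energy s x \<partial>M"
    have "?L \<le> (\<integral>\<^sup>+x. 4 * density_energy s x \<partial>M)"
      by (intro nn_integral_mono square_function_le)
    also have "\<dots> = 4 * ?R" by (rule nn_integral_cmult) measurable
    also have "\<dots> \<le> ennreal c * ?R"
      by (intro mult_right_mono) (auto simp: c_def simp flip: ennreal_numeral intro!: ennreal_leI)
    finally have LR: "?L \<le> ennreal c * ?R" .
    have "?R \<le> ennreal (2 + real A * real A * real (card D)) * ?L"
      using A D loc[OF radon]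
      by (intro density_energy_le) (auto simp: ennreal_of_nat_eq_real_of_nat)
    also have "\<dots> \<le> ennreal c * ?L" by (intro mult_right_mono ennreal_leI) (auto simp: c_def)
    finally have "?R \<le> ennreal c * ?L" .
    with LR show "let L = ?L; R = \<integral>\<^sup>+x. wolff (2/3 * (real DIM('a) - s)) (3/2) M x \<partial>M
      in L \<le> ennreal c * R \<and> R \<le> ennreal c * L"
      unfolding Let_def wolff_eq by blast
  qed
qed

end
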